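(* Let $(X,S,\mathcal{A})$ be a stationarily measurable space. Then there exists an inverse monoid $\mathcal{Q}(X,S,\mathcal{A})$ such that the type monoid $\mathcal{T}(X,S,\mathcal{A})$ embeds into $\mathcal{Q}(X,S,\mathcal{A})$. Moreover, $\mathcal{Q}(X,S,\mathcal{A})$ is commutative, partially ordered, and its idempotents form a distributive lattice.
   Context: An inverse monoid is a monoid $S$ in which every $s$ has a unique weak inverse $s^*$ with $ss^*s=s$ and $s^*ss^*=s^*$. A stationarily measurable space $(X,S,\mathcal{A})$ consists of a set $X$ with a $\sigma$-algebra $\mathcal{A}$ of subsets and an inverse monoid $S$ acting on $X$ from the left by measurable maps: $1$ acts as the identity, $(st)x=s(tx)$, and each map $x\mapsto sx$ is $(\mathcal{A},\mathcal{A})$-measurable. For $s\in S$ and $A\in\mathcal{A}$, $s^{-1}A=\{x\in X: sx\in A\}$ is the preimage. $\overline{\mathcal{A}}$ denotes the closure of $\mathcal{A}$ under countable coproducts (disjoint unions): its elements are the coproducts $\coprod_{j\in J}P_j$ with $J$ countable and $P_j\in\mathcal{A}$ (realized as $\bigcup_j P_j\times\{j\}$). The representation is unique up to measurable partitions: $\coprod_j P_j$ and $\coprod_k Q_k$ are the same element when there are $R_{jk}\in\mathcal{A}$ with $P_j=\bigsqcup_k R_{jk}$ and $Q_k=\bigsqcup_j R_{jk}$; in particular $A\in\mathcal{A}$ is identified with $\coprod_j A_j$ for any countable measurable partition $(A_j)$ of $A$. $S$ acts by $s^{-1}\left(\coprod_j P_j\right)=\coprod_j s^{-1}P_j$. For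 $P,Q\in\overline{\mathcal{A}}$, write $P\eqsim_S Q$ iff there are countable collections $(P_j),(Q_j)\subseteq\overline{\mathcal{A}}$ and $(s_j),(t_j)\subseteq S$ with $P=\coprod_j P_j$, $Q=\coprod_j Q_j$ and $s_j^{-1}P_j=t_j^{-1}Q_j$ for all $j$. The type monoid is $\mathcal{T}(X,S,\mathcal{A})=\overline{\mathcal{A}}/\eqsim_S=\{[P]:P\in\overline{\mathcal{A}}\}$ with $[P]+[Q]=[P\coprod Q]$ and $0=[\varnothing]$. The monoid operation of $\mathcal{Q}(X,S,\mathcal{A})$ is written $+$; an embedding is an injective monoid homomorphism. On idempotents $e,f$ the lattice order is $e\preceq f\iff e+f=f$, so the join is $e\vee f=e+f$. *)

theory Defs
  imports
    "HOL-Analysis.Sigma_Algebra"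
    "HOL-Library.Nat_Bijection"
    "HOL-Algebra.Group"
begin

section \<open>Inverse monoids\<close>

definition weak_inverse :: "('a, 'm) monoid_scheme \<Rightarrow> 'a \<Rightarrow> 'a \<Rightarrow> bool" where
  "weak_inverse G s t \<longleftrightarrow>
     t \<in> carrier G \<and>
     s \<otimes>\<^bsub>G\<^esub> t \<otimes>\<^bsub>G\<^esub> s = s \<and>
     t \<otimes>\<^bsub>G\<^esub> s \<otimes>\<^bsub>G\<^esub> t = t"

locale inverse_monoid = Group.monoid G for G (structure) +
  assumes unique_weak_inverse: "s \<in> carrier G \<Longrightarrow> \<exists>!t. weak_inverse G s t"

definition idempotents :: "('a, 'm) monoid_scheme \<Rightarrow> 'a set" where
  "idempotents G = {e \<in> carrier G. e \<otimes>\<^bsub>G\<^esub> e = e}"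

text \<open>With \<open>\<otimes>\<close> read additively, this is the order for which the join of two commuting
  idempotents \<open>e\<close> and \<open>f\<close> is \<open>e \<otimes> f\<close>; it is opposite to the usual natural order.\<close>

definition idempotent_order :: "('a, 'm) monoid_scheme \<Rightarrow> 'a gorder" where
  "idempotent_order G =
     \<lparr>carrier = idempotents G, eq = (=), le = (\<lambda>e f. e \<otimes>\<^bsub>G\<^esub> f = f)\<rparr>"

locale distributive_lattice = Lattice.lattice L for L (structure) +
  assumes meet_join_distrib:
    "\<lbrakk>x \<in> carrier L; y \<in> carrier L; z \<in> carrier L\<rbrakk>
       \<Longrightarrow> x \<sqinter> (y \<squnion> z) = (x \<sqinter> y) \<squnion> (x \<sqinter> z)"

locale partially_ordered_comm_monoid = comm_monoid G for G (structure) +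
  fixes ord :: "'a \<Rightarrow> 'a \<Rightarrow> bool"
  assumes order: "partial_order \<lparr>carrier = carrier G, eq = (=), le = ord\<rparr>"
    and mult_mono:
      "\<lbrakk>x \<in> carrier G; y \<in> carrier G; z \<in> carrier G; ord x y\<rbrakk> \<Longrightarrow> ord (x \<otimes> z) (y \<otimes> z)"

definition monoid_embedding ::
  "('a \<Rightarrow> 'b) \<Rightarrow> ('a, 'm) monoid_scheme \<Rightarrow> ('b, 'n) monoid_scheme \<Rightarrow> bool" where
  "monoid_embedding \<phi> G H \<longleftrightarrow>
     \<phi> \<in> hom G H \<and> \<phi> \<one>\<^bsub>G\<^esub> = \<one>\<^bsub>H\<^esub> \<and> inj_on \<phi> (carrier G)"


section \<open>Stationarily measurable spaces\<close>

text \<open>Only \<open>space M\<close> and \<open>sets M\<close> matter; the measure carried by \<open>M\<close> is never used.\<close>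

locale stationarily_measurable_space = inverse_monoid S
  for M :: "'x measure" and S :: "('s, 'm) monoid_scheme" (structure)
    and act :: "'s \<Rightarrow> 'x \<Rightarrow> 'x" +
  assumes act_one: "x \<in> space M \<Longrightarrow> act \<one> x = x"
    and act_mult:
      "\<lbrakk>s \<in> carrier S; t \<in> carrier S; x \<in> space M\<rbrakk> \<Longrightarrow> act (s \<otimes> t) x = act s (act t x)"
    and act_measurable: "s \<in> carrier S \<Longrightarrow> act s \<in> measurable M M"


section \<open>Countable coproducts of measurable sets\<close>

text \<open>
  The coproduct of a countable family of measurable sets is represented by a sequence
  \<open>P :: nat \<Rightarrow> 'x set\<close>, standing for the union of the sets \<open>P j \<times> {j}\<close>. Families over other
  countable index sets are reindexed by natural numbers and padded with empty sets, which the
  identification \<open>same_coproduct\<close> does not see. A sequence is thus a representative, and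
  equality of coproducts is \<open>same_coproduct\<close>, not \<open>=\<close>.
\<close>

type_synonym 'x coproduct = "nat \<Rightarrow> 'x set"

definition coproducts :: "'x measure \<Rightarrow> 'x coproduct set" where
  "coproducts M = {P. \<forall>j. P j \<in> sets M}"

definition same_coproduct :: "'x measure \<Rightarrow> 'x coproduct \<Rightarrow> 'x coproduct \<Rightarrow> bool" where
  "same_coproduct M P Q \<longleftrightarrow>
     (\<exists>R :: nat \<Rightarrow> nat \<Rightarrow> 'x set.
        (\<forall>j k. R j k \<in> sets M) \<and>
        (\<forall>j. disjoint_family (\<lambda>k. R j k) \<and> P j = (\<Union>k. R j k)) \<and>
        (\<forall>k. disjoint_family (\<lambda>j. R j k) \<and> Q k = (\<Union>j. R j k)))"

definition empty_coproduct :: "'x coproduct" where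
  "empty_coproduct = (\<lambda>_. {})"

definition coproduct2 :: "'x coproduct \<Rightarrow> 'x coproduct \<Rightarrow> 'x coproduct" where
  "coproduct2 P Q = (\<lambda>n. case sum_decode n of Inl j \<Rightarrow> P j | Inr k \<Rightarrow> Q k)"

definition countable_coproduct :: "(nat \<Rightarrow> 'x coproduct) \<Rightarrow> 'x coproduct" where
  "countable_coproduct P = (\<lambda>n. case prod_decode n of (j, k) \<Rightarrow> P j k)"

definition coproduct_preimage ::
  "'x measure \<Rightarrow> ('s \<Rightarrow> 'x \<Rightarrow> 'x) \<Rightarrow> 's \<Rightarrow> 'x coproduct \<Rightarrow> 'x coproduct" where
  "coproduct_preimage M act s P = (\<lambda>j. {x \<in> space M. act s x \<in> P j})"


section \<open>The type monoid\<close>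

definition equidecomposable ::
  "'x measure \<Rightarrow> ('s, 'm) monoid_scheme \<Rightarrow> ('s \<Rightarrow> 'x \<Rightarrow> 'x) \<Rightarrow> ('x coproduct \<times> 'x coproduct) set"
where
  "equidecomposable M S act =
     {(P, Q). P \<in> coproducts M \<and> Q \<in> coproducts M \<and>
        (\<exists>(P' :: nat \<Rightarrow> 'x coproduct) (Q' :: nat \<Rightarrow> 'x coproduct) s t.
           (\<forall>j. P' j \<in> coproducts M \<and> Q' j \<in> coproducts M \<and>
                s j \<in> carrier S \<and> t j \<in> carrier S) \<and>
           same_coproduct M P (countable_coproduct P') \<and>
           same_coproduct M Q (countable_coproduct Q') \<and>
           (\<forall>j. same_coproduct M (coproduct_preimage M act (s j) (P' j))
                                 (coproduct_preimage M act (t j) (Q' j))))}"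

type_synonym 'x coproduct_type = "'x coproduct set"

text \<open>Since \<open>equidecomposable\<close> contains \<open>same_coproduct\<close>, passing to the quotient by it also
  identifies different representatives of the same coproduct.\<close>

definition type_monoid ::
  "'x measure \<Rightarrow> ('s, 'm) monoid_scheme \<Rightarrow> ('s \<Rightarrow> 'x \<Rightarrow> 'x) \<Rightarrow> 'x coproduct_type monoid" where
  "type_monoid M S act =
     \<lparr>carrier = coproducts M // equidecomposable M S act,
      mult = (\<lambda>a b. \<Union>P\<in>a. \<Union>Q\<in>b. equidecomposable M S act `` {coproduct2 P Q}),
      one = equidecomposable M S act `` {empty_coproduct}\<rparr>"

end

theory Submission
  imports Defs "HOL-Algebra.Divisibility" "HOL-Algebra.Coset" "HOL-Analysis.Measurable"
    "HOL-Library.Equipollence"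
begin

text \<open>
  A commutative inverse monoid is a semilattice of abelian groups. In such a monoid
  \<open>a + k = b + k\<close> forces \<open>a = b\<close> as soon as \<open>k\<close> lies below multiples of both \<open>a\<close> and \<open>b\<close>:
  with \<open>k'\<close> the weak inverse of \<open>k\<close>, the idempotent \<open>k + k'\<close> changes neither \<open>a\<close> nor \<open>b\<close>, so
  that adding \<open>k'\<close> to both sides yields \<open>a = b\<close>. So the type monoid must satisfy
  this restricted cancellation law, and the proof shows that it does (\<open>separative\<close>) and that,
  together with the refinement property, this suffices. The monoids are written multiplicatively
  below; the comments use additive notation, with \<open>a \<le> b\<close> for divisibility, which is the
  algebraic preorder. An element \<open>c\<close> absorbs \<open>x\<close> if \<open>c + x = c\<close>.

  The envelope. For an order ideal \<open>I\<close> of a refinement monoid \<open>T\<close>, that is, a hereditary submonoid,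
  let \<open>G(I)\<close> be the group of formal differences of elements of \<open>I\<close>, where \<open>a - b\<close> and \<open>c - d\<close>
  agree if \<open>a + d + k = b + c + k\<close> for some \<open>k\<close> in \<open>I\<close>. The disjoint union of all the \<open>G(I)\<close>, with
  the sum of an element of \<open>G(I)\<close> and one of \<open>G(J)\<close> formed in \<open>G(I + J)\<close>, is a commutative
  inverse monoid (\<open>clifford_envelope\<close>). Its idempotents are the neutral elements of the
  groups \<open>G(I)\<close>, hence correspond to the order ideals, with join \<open>I + J\<close> and meet \<open>I \<inter> J\<close>;
  refinement makes \<open>I + J\<close> hereditary and the lattice distributive (\<open>ideal_distrib\<close>). All order
  ideals are used, not only the principal ones, because a meet of principal ideals need not be
  principal. The partial order is \<open>x \<le> x + e\<close> for idempotents \<open>e\<close>. An element \<open>a\<close> of \<open>T\<close> is sent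
  to the class of \<open>a - 0\<close> in \<open>G(I)\<close>, where \<open>I\<close> is the ideal generated by \<open>a\<close>, and injectivity of
  this map is exactly the restricted cancellation law (\<open>embedding_envelope\<close>).

  Cancellation. The type monoid has the refinement property, countable sums, and the
  remainder property: if \<open>a n = b n + a (n + 1)\<close> for all \<open>n\<close>, then some \<open>c\<close> satisfies
  \<open>a n = c + (\<Sum>i. b (n + i))\<close>. These properties are among the laws of Tarski's cardinal algebras. Iterating
  refinement on \<open>a + c = b + c\<close> and taking the remainders gives \<open>a = r + y\<close> and \<open>b = r + z\<close> where
  \<open>c\<close> absorbs \<open>y\<close> and \<open>z\<close> (\<open>cancel_up_to_absorbed\<close>). If a sum absorbs \<open>x\<close>, then \<open>x\<close> splits into
  parts absorbed by the summands (\<open>absorbed_by_product\<close>), so whatever a multiple of \<open>a\<close> absorbs is already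
  absorbed by \<open>a\<close>. If \<open>c\<close> lies below multiples of \<open>a\<close> and of \<open>b\<close>, both absorb \<open>y\<close> and \<open>z\<close>, and
  \<open>a = a + z = r + y + z = b + y = b\<close>.

  The type monoid. A coproduct is determined up to identification by the number of times
  each point is covered (\<open>same_coproduct_iff\<close>). Equidecomposability of coproducts therefore reduces to the
  relation \<open>s\<^sup>-\<^sup>1 A = t\<^sup>-\<^sup>1 B\<close> between measurable sets. This relation is transitive, because
  idempotents of \<open>S\<close> commute and so \<open>t a = u b\<close> can be solved (\<open>translates_trans\<close>), and a partition of one
  side can be transported to the other (\<open>translates_partition\<close>). Hence any type equation can be
  realised by literal partitions of a representative (\<open>equi_coproduct2_split\<close>), from which
  refinement and remainders are read off; the remainder of a decreasing sequence of
  representatives is their intersection.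
\<close>


section \<open>Cancellation in monoids with countable sums\<close>

locale refinement_monoid = comm_monoid G for G (structure) +
  assumes refinement:
    "\<lbrakk>a \<in> carrier G; b \<in> carrier G; c \<in> carrier G; d \<in> carrier G; a \<otimes> b = c \<otimes> d\<rbrakk>
      \<Longrightarrow> \<exists>w\<in>carrier G. \<exists>x\<in>carrier G. \<exists>y\<in>carrier G. \<exists>z\<in>carrier G.
            a = w \<otimes> x \<and> b = y \<otimes> z \<and> c = w \<otimes> y \<and> d = x \<otimes> z"
begin

lemma refinementE:
  assumes "a \<otimes> b = c \<otimes> d" "a \<in> carrier G" "b \<in> carrier G" "c \<in> carrier G" "d \<in> carrier G"
  obtains w x y z where "w \<in> carrier G" "x \<in> carrier G" "y \<in> carrier G" "z \<in> carrier G"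
    "a = w \<otimes> x" "b = y \<otimes> z" "c = w \<otimes> y" "d = x \<otimes> z"
  using refinement[OF assms(2-5,1)] by blast

lemma riesz_decomposition:
  assumes "c divides a \<otimes> b" "a \<in> carrier G" "b \<in> carrier G" "c \<in> carrier G"
  obtains a' b' where "a' \<in> carrier G" "b' \<in> carrier G" "c = a' \<otimes> b'" "a' divides a" "b' divides b"
proof -
  from assms(1) obtain d where d: "d \<in> carrier G" "a \<otimes> b = c \<otimes> d"
    by (rule dividesE)
  from d assms obtain w x y z where *: "w \<in> carrier G" "x \<in> carrier G" "y \<in> carrier G" "z \<in> carrier G"
    "a = w \<otimes> x" "b = y \<otimes> z" "c = w \<otimes> y"
    by (elim refinementE)
  then show thesis by (intro that[of w y]) auto
qed

end

text \<open>
  The remainder law is the algebraic form of intersecting a decreasing sequence of sets: \<open>a n\<close>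
  consists of the layers \<open>b n, b (n + 1), \<dots>\<close> that are removed one after the other and of a limit
  \<open>c\<close> common to all \<open>a n\<close>.
\<close>

locale countable_sum_monoid = refinement_monoid G for G (structure) +
  fixes sum :: "(nat \<Rightarrow> 'a) \<Rightarrow> 'a"  (\<open>\<Sigma>\<close>)
  assumes sum_closed: "(\<And>n. f n \<in> carrier G) \<Longrightarrow> \<Sigma> f \<in> carrier G"
    and sum_Suc: "(\<And>n. f n \<in> carrier G) \<Longrightarrow> \<Sigma> f = f 0 \<otimes> \<Sigma> (\<lambda>n. f (Suc n))"
    and sum_mult: "\<lbrakk>\<And>n. f n \<in> carrier G; \<And>n. g n \<in> carrier G\<rbrakk> \<Longrightarrow> \<Sigma> (\<lambda>n. f n \<otimes> g n) = \<Sigma> f \<otimes> \<Sigma> g"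
    and remainder:
      "\<lbrakk>\<And>n. a n \<in> carrier G; \<And>n. b n \<in> carrier G; \<And>n. a n = b n \<otimes> a (Suc n)\<rbrakk>
        \<Longrightarrow> \<exists>c\<in>carrier G. \<forall>n. a n = c \<otimes> \<Sigma> (\<lambda>i. b (n + i))"
begin

lemma absorbs_const_sum:
  assumes "x \<in> carrier G"
  shows "\<Sigma> (\<lambda>n. x) \<otimes> x = \<Sigma> (\<lambda>n. x)"
  using sum_Suc[of "\<lambda>n. x"] assms m_comm sum_closed[of "\<lambda>n. x"] by simp

text \<open>
  An element \<open>c\<close> that absorbs \<open>w\<close> contains infinitely many copies of it: the
  constant sequence \<open>c\<close> has remainders, so \<open>c = r + \<Sigma> w\<close>. Infinitely many copies of a sum
  are infinitely many copies of each summand.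
\<close>

lemma absorbs_factor:
  assumes "c \<otimes> (x \<otimes> x') = c" "c \<in> carrier G" "x \<in> carrier G" "x' \<in> carrier G"
  shows "c \<otimes> x = c"
proof -
  obtain r where r: "r \<in> carrier G" "c = r \<otimes> \<Sigma> (\<lambda>i. x \<otimes> x')"
    using remainder[of "\<lambda>_. c" "\<lambda>_. x \<otimes> x'"] assms by (metis m_closed m_comm)
  have "c = r \<otimes> (\<Sigma> (\<lambda>_. x) \<otimes> \<Sigma> (\<lambda>_. x'))"
    using r assms sum_mult[of "\<lambda>_. x" "\<lambda>_. x'"] by simp
  then have c: "c = r \<otimes> \<Sigma> (\<lambda>_. x') \<otimes> \<Sigma> (\<lambda>_. x)"
    using r assms sum_closed by (simp add: m_ac)
  then have "c \<otimes> x = r \<otimes> \<Sigma> (\<lambda>_. x') \<otimes> (\<Sigma> (\<lambda>_. x) \<otimes> x)"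
    using r assms sum_closed by (simp add: m_assoc)
  then show ?thesis
    using c absorbs_const_sum assms by simp
qed

lemma absorbs_divides:
  assumes "c \<otimes> y = c" "x divides y" "c \<in> carrier G" "x \<in> carrier G"
  shows "c \<otimes> x = c"
  using assms absorbs_factor by (metis dividesE)

lemma absorbs_if_divides:
  assumes "c \<otimes> x = c" "c divides d" "c \<in> carrier G" "x \<in> carrier G"
  shows "d \<otimes> x = d"
proof -
  from assms(2) obtain e where "e \<in> carrier G" "d = c \<otimes> e" by (rule dividesE)
  then show ?thesis using assms by (metis m_assoc m_comm)
qed

lemma absorbs_mult:
  assumes "c \<otimes> x = c" "c \<otimes> y = c" "c \<in> carrier G" "x \<in> carrier G" "y \<in> carrier G"
  shows "c \<otimes> (x \<otimes> y) = c"
  using assms by (metis m_assoc)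

text \<open>
  Refining \<open>y + c = z + c\<close> gives \<open>y = x + y'\<close>, \<open>z = x + z'\<close> and \<open>c = y' + c' = z' + c'\<close>, where again
  \<open>y' + c' = z' + c'\<close>. Iteration splits off from \<open>a\<close> and from \<open>b\<close> the same summands
  \<open>x\<^sub>0, x\<^sub>1, \<dots>\<close>, whose sum is \<open>r\<close>. The remainders \<open>y\<close> and \<open>z\<close> stay inside every
  stage, so \<open>c\<close> loses a copy of each of them infinitely often and therefore absorbs them.
\<close>

lemma cancel_up_to_absorbed:
  assumes eq: "a \<otimes> c = b \<otimes> c" and "a \<in> carrier G" "b \<in> carrier G" "c \<in> carrier G"
  obtains r y z where "r \<in> carrier G" "y \<in> carrier G" "z \<in> carrier G"
    "a = r \<otimes> y" "b = r \<otimes> z" "c \<otimes> y = c" "c \<otimes> z = c"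
proof -
  define P where "P = (\<lambda>(y, z, c). y \<in> carrier G \<and> z \<in> carrier G \<and> c \<in> carrier G \<and> y \<otimes> c = z \<otimes> c)"
  define Q where "Q = (\<lambda>(y, z, c) (y', z', c'). \<exists>x\<in>carrier G.
     y = x \<otimes> y' \<and> z = x \<otimes> z' \<and> c = z' \<otimes> c' \<and> c = y' \<otimes> c')"
  have "\<exists>t'. P t' \<and> Q t t'" if t: "P t" for t
  proof (cases t)
    case (fields y z c)
    with t have yz: "y \<otimes> c = z \<otimes> c" "y \<in> carrier G" "z \<in> carrier G" "c \<in> carrier G"
      by (simp_all add: P_def)
    obtain x y' z' c' where "x \<in> carrier G" "y' \<in> carrier G" "z' \<in> carrier G" "c' \<in> carrier G"
      "y = x \<otimes> y'" "c = z' \<otimes> c'" "z = x \<otimes> z'" "c = y' \<otimes> c'"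
      using refinementE[OF yz(1,2,4,3,4)] .
    then have "P (y', z', c') \<and> Q t (y', z', c')"
      unfolding fields P_def Q_def prod.case by metis
    then show ?thesis ..
  qed
  moreover have "P (a, b, c)" using assms by (simp add: P_def)
  ultimately obtain f where f: "\<And>n. P (f n)" "f 0 = (a, b, c)" "\<And>n. Q (f n) (f (Suc n))"
    using dependent_nat_choice[of "\<lambda>n t. P t \<and> (n = 0 \<longrightarrow> t = (a, b, c))" "\<lambda>_. Q"]
    by (metis (no_types, lifting) nat.distinct(1))
  define Y where "Y n = fst (f n)" for n
  define Z where "Z n = fst (snd (f n))" for n
  define C where "C n = snd (snd (f n))" for n
  have f_eq: "f n = (Y n, Z n, C n)" for n by (simp add: Y_def Z_def C_def)
  have YZC [simp]: "Y n \<in> carrier G" "Z n \<in> carrier G" "C n \<in> carrier G" for n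
    using f(1)[of n] by (auto simp: f_eq P_def)
  have f0: "Y 0 = a" "Z 0 = b" "C 0 = c" using f(2) by (auto simp: f_eq)
  have "\<forall>n. \<exists>x\<in>carrier G. Y n = x \<otimes> Y (Suc n) \<and> Z n = x \<otimes> Z (Suc n)
          \<and> C n = Z (Suc n) \<otimes> C (Suc n) \<and> C n = Y (Suc n) \<otimes> C (Suc n)"
    using f(3) by (simp add: f_eq Q_def)
  then obtain X where X [simp]: "\<And>n. X n \<in> carrier G"
    and step: "\<And>n. Y n = X n \<otimes> Y (Suc n)" "\<And>n. Z n = X n \<otimes> Z (Suc n)"
      "\<And>n. C n = Z (Suc n) \<otimes> C (Suc n)" "\<And>n. C n = Y (Suc n) \<otimes> C (Suc n)"
    by metis
  obtain y where y: "y \<in> carrier G" "\<And>n. Y n = y \<otimes> \<Sigma> (\<lambda>i. X (n + i))"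
    using remainder[of Y X, OF YZC(1) X step(1)] by blast
  obtain z where z: "z \<in> carrier G" "\<And>n. Z n = z \<otimes> \<Sigma> (\<lambda>i. X (n + i))"
    using remainder[of Z X, OF YZC(2) X step(2)] by blast
  \<comment> \<open>applied to \<open>Y\<close> with remainder \<open>y\<close> and to \<open>Z\<close> with remainder \<open>z\<close>\<close>
  have absorb: "c \<otimes> w = c"
    if w: "w \<in> carrier G" and W: "\<And>n. W n = w \<otimes> \<Sigma> (\<lambda>i. X (n + i))"
      and C: "\<And>n. C n = W (Suc n) \<otimes> C (Suc n)" for w W
  proof -
    have W': "W n \<in> carrier G" for n
      unfolding W by (intro m_closed w sum_closed X)
    obtain r where r: "r \<in> carrier G" "C 0 = r \<otimes> \<Sigma> (\<lambda>i. W (Suc (0 + i)))"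
      using remainder[of C "\<lambda>n. W (Suc n)", OF YZC(3) W' C] by blast
    have s: "\<Sigma> (\<lambda>j. X (Suc i + j)) \<in> carrier G" for i
      by (rule sum_closed) simp
    have "\<Sigma> (\<lambda>i. W (Suc (0 + i))) = \<Sigma> (\<lambda>i. w) \<otimes> \<Sigma> (\<lambda>i. \<Sigma> (\<lambda>j. X (Suc i + j)))"
      using sum_mult[of "\<lambda>i. w", OF w s] by (simp add: W)
    moreover have "\<Sigma> (\<lambda>i. \<Sigma> (\<lambda>j. X (Suc i + j))) \<in> carrier G"
      using s by (rule sum_closed)
    moreover have "\<Sigma> (\<lambda>i. w) \<in> carrier G" using w by (rule sum_closed)
    ultimately have "\<Sigma> (\<lambda>i. w) divides c"
      using r(1) r(2) f0 by (intro dividesI[of "r \<otimes> \<Sigma> (\<lambda>i. \<Sigma> (\<lambda>j. X (Suc i + j)))"]) (simp_all add: m_ac)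
    then show ?thesis
      using absorbs_if_divides[OF absorbs_const_sum[OF w]] w \<open>\<Sigma> (\<lambda>i. w) \<in> carrier G\<close> by blast
  qed
  show thesis
  proof (rule that[of "\<Sigma> X" y z])
    show SX: "\<Sigma> X \<in> carrier G" by (rule sum_closed) simp
    show "a = \<Sigma> X \<otimes> y" using y(2)[of 0] y(1) f0(1) m_comm[OF SX y(1)] by simp
    show "b = \<Sigma> X \<otimes> z" using z(2)[of 0] z(1) f0(2) m_comm[OF SX z(1)] by simp
    show "c \<otimes> y = c" using absorb[OF y(1) y(2)] step(4) by blast
    show "c \<otimes> z = c" using absorb[OF z(1) z(2)] step(3) by blast
  qed (use y z in auto)
qed

text \<open>
  Cancelling \<open>p\<close> from \<open>(q + x) + p = q + p\<close> up to elements absorbed by \<open>p\<close> leaves only the part \<open>x1\<close> of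
  \<open>x\<close> that is still contained in \<open>r \<le> q\<close>. Comparing the two resulting decompositions of
  \<open>q\<close> and cancelling once more, now up to elements absorbed by \<open>q\<close>, splits \<open>x1\<close> as
  required.
\<close>

lemma absorbed_by_product:
  assumes "p \<otimes> q \<otimes> x = p \<otimes> q" and c: "p \<in> carrier G" "q \<in> carrier G" "x \<in> carrier G"
  obtains x1 x2 where "x1 \<in> carrier G" "x2 \<in> carrier G" "x = x1 \<otimes> x2" "p \<otimes> x1 = p" "q \<otimes> x2 = q"
proof -
  have "(q \<otimes> x) \<otimes> p = q \<otimes> p" using assms by (simp add: m_ac)
  then obtain r y z where ryz: "r \<in> carrier G" "y \<in> carrier G" "z \<in> carrier G"
    "q \<otimes> x = r \<otimes> y" "q = r \<otimes> z" "p \<otimes> y = p" "p \<otimes> z = p"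
    by (rule cancel_up_to_absorbed) (use c in auto)
  from ryz(4) obtain q1 q2 x1 x2 where qx: "q1 \<in> carrier G" "q2 \<in> carrier G" "x1 \<in> carrier G" "x2 \<in> carrier G"
    "q = q1 \<otimes> q2" "x = x1 \<otimes> x2" "r = q1 \<otimes> x1" "y = q2 \<otimes> x2"
    using c ryz by (elim refinementE) auto
  \<comment> \<open>\<open>p\<close> absorbs \<open>x2\<close> and \<open>q2\<close>, which are parts of \<open>y\<close>; it remains to distribute \<open>x1\<close>, and
    \<open>q = q1 + q2 = r + z = q1 + x1 + z\<close> bounds it by \<open>q2\<close> up to what \<open>q1\<close> absorbs\<close>
  have "q2 \<otimes> q1 = (x1 \<otimes> z) \<otimes> q1"
    using qx ryz by (metis m_assoc m_comm)
  then obtain r' y' z' where r': "r' \<in> carrier G" "y' \<in> carrier G" "z' \<in> carrier G"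
    "q2 = r' \<otimes> y'" "x1 \<otimes> z = r' \<otimes> z'" "q1 \<otimes> y' = q1" "q1 \<otimes> z' = q1"
    by (rule cancel_up_to_absorbed) (use qx ryz in auto)
  have "x1 divides r' \<otimes> z'"
    using r' qx ryz by (metis divides_prod_r divides_refl dividesI)
  then obtain u v where uv: "u \<in> carrier G" "v \<in> carrier G" "x1 = u \<otimes> v" "u divides r'" "v divides z'"
    using r' qx by (elim riesz_decomposition) auto
  have "p \<otimes> q2 = p" "p \<otimes> x2 = p"
    using absorbs_factor[of p q2 x2] absorbs_factor[of p x2 q2] ryz(6) qx(2,4,8) c
    by (simp_all add: m_comm[of q2 x2])
  moreover have "p \<otimes> u = p"
    using uv r' \<open>p \<otimes> q2 = p\<close> c qx
    by (meson absorbs_divides dividesI divides_trans)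
  moreover have "q \<otimes> v = q"
  proof -
    have "q1 \<otimes> v = q1" using uv r' qx by (meson absorbs_divides)
    then show ?thesis
      using qx uv by (meson absorbs_if_divides dividesI)
  qed
  ultimately show thesis
    using c qx uv by (intro that[of "u \<otimes> x2" v]) (auto simp: m_ac absorbs_mult)
qed

lemma absorbed_by_power:
  assumes "a [^] (n::nat) \<otimes> x = a [^] n" and c: "a \<in> carrier G" "x \<in> carrier G"
  shows "a \<otimes> x = a"
  using assms
proof (induction n arbitrary: x)
  case 0
  then show ?case by simp
next
  case (Suc n)
  then have "a [^] n \<otimes> a \<otimes> x = a [^] n \<otimes> a" by simp
  then obtain x1 x2 where *: "x1 \<in> carrier G" "x2 \<in> carrier G" "x = x1 \<otimes> x2"
     "a [^] n \<otimes> x1 = a [^] n" "a \<otimes> x2 = a"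
    by (rule absorbed_by_product) (use Suc.prems in auto)
  then have "a \<otimes> x1 = a" using Suc by blast
  then show ?case using * Suc.prems by (simp add: absorbs_mult)
qed

text \<open>
  The name is the usual one for commutative monoids in which \<open>2a = a + b = 2b\<close> implies \<open>a = b\<close>,
  a law equivalent to this cancellation property.
\<close>

lemma separative:
  assumes eq: "a \<otimes> k = b \<otimes> k" and k: "k divides a [^] (n::nat)" "k divides b [^] (m::nat)"
    and c: "a \<in> carrier G" "b \<in> carrier G" "k \<in> carrier G"
  shows "a = b"
proof -
  obtain r y z where r: "r \<in> carrier G" "y \<in> carrier G" "z \<in> carrier G"
    "a = r \<otimes> y" "b = r \<otimes> z" "k \<otimes> y = k" "k \<otimes> z = k"
    using cancel_up_to_absorbed[OF eq c] .
  have "a \<otimes> z = a"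
    using absorbed_by_power absorbs_if_divides[OF r(7) k(1)] c r(3) by blast
  moreover have "b \<otimes> y = b"
    using absorbed_by_power absorbs_if_divides[OF r(6) k(2)] c r(2) by blast
  ultimately show ?thesis
    using r(1-5) by (metis m_assoc m_comm)
qed

end

section \<open>The Clifford envelope of a refinement monoid\<close>

definition order_ideal :: "('a, 'm) monoid_scheme \<Rightarrow> 'a set \<Rightarrow> bool" where
  "order_ideal G I \<longleftrightarrow> I \<subseteq> carrier G \<and> \<one>\<^bsub>G\<^esub> \<in> I \<and> (\<forall>a\<in>I. \<forall>b\<in>I. a \<otimes>\<^bsub>G\<^esub> b \<in> I) \<and>
     (\<forall>a\<in>I. \<forall>c\<in>carrier G. c divides\<^bsub>G\<^esub> a \<longrightarrow> c \<in> I)"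

text \<open>
  The formal difference \<open>a - b\<close> in the Grothendieck group of \<open>I\<close>, as an equivalence class of
  pairs. Representing it by a set of pairs from \<open>I\<close> also records \<open>I\<close> itself, see
  \<open>underlying_ideal_difference\<close>, so classes of different ideals never coincide.
\<close>

definition difference :: "('a, 'm) monoid_scheme \<Rightarrow> 'a set \<Rightarrow> 'a \<Rightarrow> 'a \<Rightarrow> ('a \<times> 'a) set" where
  "difference G I a b =
     {(c, d). c \<in> I \<and> d \<in> I \<and> (\<exists>k\<in>I. a \<otimes>\<^bsub>G\<^esub> d \<otimes>\<^bsub>G\<^esub> k = b \<otimes>\<^bsub>G\<^esub> c \<otimes>\<^bsub>G\<^esub> k)}"

text \<open>
  The first components of a class \<open>a - b\<close> need not exhaust \<open>I\<close>, but all \<open>a + c\<close> with \<open>c\<close> in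
  \<open>I\<close> occur among them, so their divisors do.
\<close>

definition underlying_ideal :: "('a, 'm) monoid_scheme \<Rightarrow> ('a \<times> 'a) set \<Rightarrow> 'a set" where
  "underlying_ideal G X = {c \<in> carrier G. \<exists>a b. (a, b) \<in> X \<and> c divides\<^bsub>G\<^esub> a}"

text \<open>
  The neutral element sits over the least order ideal, which consists of the invertible elements.
\<close>

definition clifford_envelope :: "('a, 'm) monoid_scheme \<Rightarrow> ('a \<times> 'a) set monoid" where
  "clifford_envelope G =
     \<lparr>carrier = {difference G I a b |I a b. order_ideal G I \<and> a \<in> I \<and> b \<in> I},
      monoid.mult = (\<lambda>X Y. \<Union>(a, b)\<in>X. \<Union>(c, d)\<in>Y.
        difference G (underlying_ideal G X <#>\<^bsub>G\<^esub> underlying_ideal G Y) (a \<otimes>\<^bsub>G\<^esub> c) (b \<otimes>\<^bsub>G\<^esub> d)),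
      one = difference G (Units G) \<one>\<^bsub>G\<^esub> \<one>\<^bsub>G\<^esub>\<rparr>"

text \<open>
  In a commutative monoid two weak inverses \<open>t\<close> and \<open>u\<close> of \<open>s\<close> always agree, so that
  their existence is all that needs checking.
\<close>

lemma (in comm_monoid) inverse_monoidI:
  assumes ex: "\<And>s. s \<in> carrier G \<Longrightarrow> \<exists>t. weak_inverse G s t"
  shows "inverse_monoid G"
proof
  fix s assume s: "s \<in> carrier G"
  obtain t where t: "weak_inverse G s t" using ex[OF s] ..
  have "u = t" if u: "weak_inverse G s u" for u
  proof -
    have *: "t \<in> carrier G" "u \<in> carrier G" "s \<otimes> t \<otimes> s = s" "t \<otimes> s \<otimes> t = t"
       "s \<otimes> u \<otimes> s = s" "u \<otimes> s \<otimes> u = u"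
      using t u by (auto simp: weak_inverse_def)
    \<comment> \<open>both equal \<open>u s t\<close>\<close>
    have "u = u \<otimes> (s \<otimes> t \<otimes> s) \<otimes> u" using * by simp
    also have "\<dots> = (u \<otimes> s \<otimes> u) \<otimes> s \<otimes> t" using *(1,2) s by (simp add: m_ac)
    also have "\<dots> = u \<otimes> s \<otimes> t" using * by simp
    also have "\<dots> = u \<otimes> s \<otimes> (t \<otimes> s \<otimes> t)" using * by simp
    also have "\<dots> = t \<otimes> (s \<otimes> u \<otimes> s) \<otimes> t" using *(1,2) s by (simp add: m_ac)
    also have "\<dots> = t" using * by simp
    finally show ?thesis .
  qed
  with t show "\<exists>!t. weak_inverse G s t" by blast
qed

context refinement_monoid
begin

lemma order_idealD:
  assumes "order_ideal G I"
  shows "I \<subseteq> carrier G" "\<one> \<in> I" "a \<in> I \<Longrightarrow> a \<in> carrier G" "a \<in> I \<Longrightarrow> b \<in> I \<Longrightarrow> a \<otimes> b \<in> I"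
    "a \<in> I \<Longrightarrow> c \<in> carrier G \<Longrightarrow> c divides a \<Longrightarrow> c \<in> I"
  using assms by (auto simp: order_ideal_def)

lemma order_ideal_Units: "order_ideal G (Units G)"
proof -
  have "c \<in> Units G" if "a \<in> Units G" "c \<in> carrier G" "c divides a" for a c
    using that by (rule_tac divides_unit)
  then show ?thesis by (auto simp: order_ideal_def)
qed

lemma order_ideal_Int: "order_ideal G I \<Longrightarrow> order_ideal G J \<Longrightarrow> order_ideal G (I \<inter> J)"
  by (auto simp: order_ideal_def)

lemma in_set_mult: "a \<in> I \<Longrightarrow> b \<in> J \<Longrightarrow> a \<otimes> b \<in> I <#> J"
  by (auto simp: set_mult_def)

lemma set_multE:
  assumes "x \<in> I <#> J"
  obtains a b where "a \<in> I" "b \<in> J" "x = a \<otimes> b"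
  using assms by (auto simp: set_mult_def)

text \<open>
  Heredity is where refinement enters: a divisor of a sum splits along the sum.
\<close>

lemma order_ideal_set_mult:
  assumes I: "order_ideal G I" and J: "order_ideal G J"
  shows "order_ideal G (I <#> J)"
  unfolding order_ideal_def
proof (intro conjI ballI impI)
  show "I <#> J \<subseteq> carrier G"
    using order_idealD(1)[OF I] order_idealD(1)[OF J] by (rule set_mult_closed)
  show "\<one> \<in> I <#> J"
    using in_set_mult[OF order_idealD(2)[OF I] order_idealD(2)[OF J]] by simp
next
  fix x y assume "x \<in> I <#> J" "y \<in> I <#> J"
  then obtain a b c d where *: "a \<in> I" "b \<in> J" "c \<in> I" "d \<in> J" "x = a \<otimes> b" "y = c \<otimes> d"
    by (elim set_multE)
  then have c: "a \<in> carrier G" "b \<in> carrier G" "c \<in> carrier G" "d \<in> carrier G"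
    using order_idealD(3)[OF I] order_idealD(3)[OF J] by auto
  have "(a \<otimes> c) \<otimes> (b \<otimes> d) \<in> I <#> J"
    using * by (intro in_set_mult order_idealD(4)[OF I] order_idealD(4)[OF J])
  also have "(a \<otimes> c) \<otimes> (b \<otimes> d) = x \<otimes> y"
    using c unfolding *(5,6) by (simp add: m_ac)
  finally show "x \<otimes> y \<in> I <#> J" .
next
  fix x c assume "x \<in> I <#> J" and c: "c \<in> carrier G" "c divides x"
  then obtain a b where ab: "a \<in> I" "b \<in> J" "x = a \<otimes> b"
    by (elim set_multE)
  have "a \<in> carrier G" "b \<in> carrier G"
    using ab order_idealD(3)[OF I] order_idealD(3)[OF J] by auto
  then obtain a' b' where *: "a' \<in> carrier G" "b' \<in> carrier G" "c = a' \<otimes> b'" "a' divides a" "b' divides b"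
    using riesz_decomposition[OF c(2)[unfolded ab(3)]] c(1) by blast
  have "a' \<in> I" "b' \<in> J"
    using order_idealD(5)[OF I ab(1) *(1,4)] order_idealD(5)[OF J ab(2) *(2,5)] .
  then show "c \<in> I <#> J"
    unfolding *(3) by (rule in_set_mult)
qed

lemma subset_set_mult_left:
  assumes "order_ideal G I" "order_ideal G J"
  shows "I \<subseteq> I <#> J"
proof
  fix a assume "a \<in> I"
  then show "a \<in> I <#> J"
    using in_set_mult[of a I \<one> J] order_idealD(3)[OF assms(1)] order_idealD(2)[OF assms(2)] by simp
qed

lemma ideal_mult_commute:
  assumes "order_ideal G I" "order_ideal G J"
  shows "I <#> J = J <#> I"
proof -
  have "A <#> B \<subseteq> B <#> A" if "order_ideal G A" "order_ideal G B" for A B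
  proof
    fix x assume "x \<in> A <#> B"
    then obtain a b where ab: "a \<in> A" "b \<in> B" "x = a \<otimes> b" by (rule set_multE)
    then have "x = b \<otimes> a"
      using m_comm order_idealD(3)[OF that(1)] order_idealD(3)[OF that(2)] by blast
    then show "x \<in> B <#> A" using ab in_set_mult by blast
  qed
  then show ?thesis using assms by blast
qed

lemma subset_set_mult_right: "order_ideal G I \<Longrightarrow> order_ideal G J \<Longrightarrow> J \<subseteq> I <#> J"
  using subset_set_mult_left[of J I] ideal_mult_commute[of I J] by simp

lemma set_mult_subset:
  assumes K: "order_ideal G K" and "I \<subseteq> K" "J \<subseteq> K"
  shows "I <#> J \<subseteq> K"
proof
  fix x assume "x \<in> I <#> J"
  then obtain a b where "a \<in> I" "b \<in> J" "x = a \<otimes> b" by (rule set_multE)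
  then show "x \<in> K" using assms(2,3) order_idealD(4)[OF K] by auto
qed

lemma set_mult_absorb:
  "order_ideal G I \<Longrightarrow> order_ideal G J \<Longrightarrow> I <#> J = J \<longleftrightarrow> I \<subseteq> J"
  using subset_set_mult_left[of I J] subset_set_mult_right[of I J] set_mult_subset[of J I J] by blast

lemma set_mult_idem: "order_ideal G I \<Longrightarrow> I <#> I = I"
  using set_mult_absorb by blast

lemma ideal_mult_assoc:
  assumes "order_ideal G I" "order_ideal G J" "order_ideal G K"
  shows "(I <#> J) <#> K = I <#> (J <#> K)"
proof -
  note ideal = assms order_ideal_set_mult[OF assms(1,2)] order_ideal_set_mult[OF assms(2,3)]
  note [simp] = order_idealD(3)[OF assms(1)] order_idealD(3)[OF assms(2)] order_idealD(3)[OF assms(3)]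
  show ?thesis
  proof
    show "(I <#> J) <#> K \<subseteq> I <#> (J <#> K)"
    proof
      fix x assume "x \<in> (I <#> J) <#> K"
      then obtain a b c where "a \<in> I" "b \<in> J" "c \<in> K" "x = a \<otimes> b \<otimes> c" by (metis set_multE)
      then show "x \<in> I <#> (J <#> K)" by (simp add: m_assoc in_set_mult)
    qed
    show "I <#> (J <#> K) \<subseteq> (I <#> J) <#> K"
    proof
      fix x assume "x \<in> I <#> (J <#> K)"
      then obtain a b c where "a \<in> I" "b \<in> J" "c \<in> K" "x = a \<otimes> (b \<otimes> c)" by (metis set_multE)
      then show "x \<in> (I <#> J) <#> K" by (simp add: m_assoc[symmetric] in_set_mult)
    qed
  qed
qed

text \<open>
  A sum that lies in \<open>I\<close> has both summands in \<open>I\<close>, by heredity.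
\<close>

lemma ideal_distrib:
  assumes I: "order_ideal G I" and J: "order_ideal G J" and K: "order_ideal G K"
  shows "I \<inter> (J <#> K) = (I \<inter> J) <#> (I \<inter> K)"
proof
  have "(I \<inter> J) <#> (I \<inter> K) \<subseteq> I"
    by (rule set_mult_subset[OF I]) auto
  moreover have "(I \<inter> J) <#> (I \<inter> K) \<subseteq> J <#> K"
    by (rule mono_set_mult) auto
  ultimately show "(I \<inter> J) <#> (I \<inter> K) \<subseteq> I \<inter> (J <#> K)" by blast
  show "I \<inter> (J <#> K) \<subseteq> (I \<inter> J) <#> (I \<inter> K)"
  proof
    fix x assume x: "x \<in> I \<inter> (J <#> K)"
    then obtain a b where ab: "a \<in> J" "b \<in> K" "x = a \<otimes> b" by (auto elim: set_multE)
    have c: "a \<in> carrier G" "b \<in> carrier G"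
      using ab order_idealD(3)[OF J] order_idealD(3)[OF K] by auto
    have "a divides x" using ab(3) c(2) by (rule dividesI')
    moreover have "b divides x" unfolding ab(3) using m_comm[OF c] c(1) by (rule dividesI')
    ultimately have "a \<in> I" "b \<in> I"
      using x c order_idealD(5)[OF I] by auto
    then show "x \<in> (I \<inter> J) <#> (I \<inter> K)"
      using ab by (simp add: in_set_mult)
  qed
qed

lemma difference_eq_iff:
  assumes I: "order_ideal G I" and ab: "a \<in> I" "b \<in> I" "c \<in> I" "d \<in> I"
  shows "difference G I a b = difference G I c d \<longleftrightarrow> (c, d) \<in> difference G I a b"
proof
  note [simp] = order_idealD(3)[OF I] order_idealD(2,4)[OF I]
  have "(c, d) \<in> difference G I c d"
    using ab by (auto simp: difference_def m_comm intro!: bexI[of _ \<one>])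
  then show "difference G I a b = difference G I c d \<Longrightarrow> (c, d) \<in> difference G I a b" by simp
  have trans: "(e, f) \<in> difference G I a b"
    if cd: "(c, d) \<in> difference G I a b" and ef: "(e, f) \<in> difference G I c d"
      and ab: "a \<in> I" "b \<in> I" for a b c d e f
  proof -
    obtain k l where k: "c \<in> I" "d \<in> I" "k \<in> I" "a \<otimes> d \<otimes> k = b \<otimes> c \<otimes> k"
      and l: "e \<in> I" "f \<in> I" "l \<in> I" "c \<otimes> f \<otimes> l = d \<otimes> e \<otimes> l"
      using cd ef by (auto simp: difference_def)
    \<comment> \<open>the product of the two equations, in which \<open>c\<close> and \<open>d\<close> occur on both sides\<close>
    have "a \<otimes> f \<otimes> (c \<otimes> d \<otimes> k \<otimes> l) = (a \<otimes> d \<otimes> k) \<otimes> (c \<otimes> f \<otimes> l)"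
      using ab k(1-3) l(1-3) by (simp add: m_ac)
    also have "\<dots> = b \<otimes> e \<otimes> (c \<otimes> d \<otimes> k \<otimes> l)"
      unfolding k(4) l(4) using ab k(1-3) l(1-3) by (simp add: m_ac)
    finally have "\<exists>k\<in>I. a \<otimes> f \<otimes> k = b \<otimes> e \<otimes> k"
      using k(1-3) l(1-3) by (intro bexI[of _ "c \<otimes> d \<otimes> k \<otimes> l"]) auto
    then show ?thesis using l by (simp add: difference_def)
  qed
  have sym: "(a, b) \<in> difference G I c d"
    if "(c, d) \<in> difference G I a b" 
    using that ab by (auto simp: difference_def m_comm eq_commute)
  assume "(c, d) \<in> difference G I a b"
  then show "difference G I a b = difference G I c d"
    using trans sym ab by (intro subset_antisym subrelI) blast+
qed

lemma in_difference:
  assumes "order_ideal G I" "a \<in> I" "b \<in> I"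
  shows "(a, b) \<in> difference G I a b"
  using difference_eq_iff[OF assms assms(2,3)] by simp

lemma underlying_ideal_difference:
  assumes I: "order_ideal G I" and ab: "a \<in> I" "b \<in> I"
  shows "underlying_ideal G (difference G I a b) = I"
proof
  show "underlying_ideal G (difference G I a b) \<subseteq> I"
    using order_idealD(5)[OF I] by (auto simp: underlying_ideal_def difference_def)
  show "I \<subseteq> underlying_ideal G (difference G I a b)"
  proof
    fix c assume c: "c \<in> I"
    note [simp] = order_idealD(3)[OF I] order_idealD(2,4)[OF I]
    have "(c \<otimes> a, c \<otimes> b) \<in> difference G I a b"
      using ab c by (auto simp: difference_def m_ac intro!: bexI[of _ \<one>])
    moreover have "c divides c \<otimes> a" using ab c by (auto intro: dividesI)
    ultimately show "c \<in> underlying_ideal G (difference G I a b)"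
      using c by (auto simp: underlying_ideal_def)
  qed
qed

abbreviation Q where "Q \<equiv> clifford_envelope G"

lemma carrier_envelopeI: "order_ideal G I \<Longrightarrow> a \<in> I \<Longrightarrow> b \<in> I \<Longrightarrow> difference G I a b \<in> carrier Q"
  by (auto simp: clifford_envelope_def)

lemma carrier_envelopeE:
  assumes "X \<in> carrier Q"
  obtains I a b where "order_ideal G I" "a \<in> I" "b \<in> I" "X = difference G I a b"
  using assms by (auto simp: clifford_envelope_def)

lemma mult_difference:
  assumes I: "order_ideal G I" and J: "order_ideal G J"
    and ab: "a \<in> I" "b \<in> I" and cd: "c \<in> J" "d \<in> J"
  shows "difference G I a b \<otimes>\<^bsub>Q\<^esub> difference G J c d = difference G (I <#> J) (a \<otimes> c) (b \<otimes> d)"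
proof -
  note IJ = order_ideal_set_mult[OF I J]
  note [simp] = order_idealD(3)[OF I] order_idealD(3)[OF J]
  have in_IJ: "x \<otimes> y \<in> I <#> J" if "x \<in> I" "y \<in> J" for x y
    using that by (auto simp: set_mult_def)
  have "difference G (I <#> J) (a' \<otimes> c') (b' \<otimes> d') = difference G (I <#> J) (a \<otimes> c) (b \<otimes> d)"
    if ab': "(a', b') \<in> difference G I a b" and cd': "(c', d') \<in> difference G J c d" for a' b' c' d'
  proof -
    obtain k l where k: "a' \<in> I" "b' \<in> I" "k \<in> I" "a \<otimes> b' \<otimes> k = b \<otimes> a' \<otimes> k"
      and l: "c' \<in> J" "d' \<in> J" "l \<in> J" "c \<otimes> d' \<otimes> l = d \<otimes> c' \<otimes> l"
      using ab' cd' by (auto simp: difference_def)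
    have "(a \<otimes> c) \<otimes> (b' \<otimes> d') \<otimes> (k \<otimes> l) = (a \<otimes> b' \<otimes> k) \<otimes> (c \<otimes> d' \<otimes> l)"
      using ab cd k(1-3) l(1-3) by (simp add: m_ac)
    also have "\<dots> = (b \<otimes> d) \<otimes> (a' \<otimes> c') \<otimes> (k \<otimes> l)"
      unfolding k(4) l(4) using ab cd k(1-3) l(1-3) by (simp add: m_ac)
    finally have "(a' \<otimes> c', b' \<otimes> d') \<in> difference G (I <#> J) (a \<otimes> c) (b \<otimes> d)"
      using k l in_IJ by (auto simp: difference_def)
    then show ?thesis
      using difference_eq_iff[OF IJ] in_IJ ab cd k l by metis
  qed
  moreover have "difference G I a b \<noteq> {}" "difference G J c d \<noteq> {}"
    using in_difference I J ab cd by blast+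
  ultimately have "(\<Union>(a', b')\<in>difference G I a b. \<Union>(c', d')\<in>difference G J c d.
       difference G (I <#> J) (a' \<otimes> c') (b' \<otimes> d')) = difference G (I <#> J) (a \<otimes> c) (b \<otimes> d)"
    by fast
  then show ?thesis
    using underlying_ideal_difference[OF I ab] underlying_ideal_difference[OF J cd]
    by (simp add: clifford_envelope_def)
qed

lemma comm_monoid_envelope: "comm_monoid Q"
proof (intro comm_monoidI)
  show "\<one>\<^bsub>Q\<^esub> \<in> carrier Q"
    using order_ideal_Units by (auto simp: clifford_envelope_def)
next
  fix X Y assume X: "X \<in> carrier Q" and Y: "Y \<in> carrier Q"
  obtain I a b where X': "order_ideal G I" "a \<in> I" "b \<in> I" "X = difference G I a b"
    using carrier_envelopeE[OF X] .
  obtain J c d where Y': "order_ideal G J" "c \<in> J" "d \<in> J" "Y = difference G J c d"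
    using carrier_envelopeE[OF Y] .
  note [simp] = X' Y' order_idealD(3)[OF X'(1)] order_idealD(3)[OF Y'(1)]
  show "X \<otimes>\<^bsub>Q\<^esub> Y \<in> carrier Q"
    by (simp add: mult_difference carrier_envelopeI order_ideal_set_mult in_set_mult)
  show "X \<otimes>\<^bsub>Q\<^esub> Y = Y \<otimes>\<^bsub>Q\<^esub> X"
    by (simp add: mult_difference ideal_mult_commute[of I J] m_comm)
next
  fix X Y Z assume X: "X \<in> carrier Q" and Y: "Y \<in> carrier Q" and Z: "Z \<in> carrier Q"
  obtain I a b where X': "order_ideal G I" "a \<in> I" "b \<in> I" "X = difference G I a b"
    using carrier_envelopeE[OF X] .
  obtain J c d where Y': "order_ideal G J" "c \<in> J" "d \<in> J" "Y = difference G J c d"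
    using carrier_envelopeE[OF Y] .
  obtain K e f where Z': "order_ideal G K" "e \<in> K" "f \<in> K" "Z = difference G K e f"
    using carrier_envelopeE[OF Z] .
  note [simp] = X' Y' Z' order_idealD(3)[OF X'(1)] order_idealD(3)[OF Y'(1)] order_idealD(3)[OF Z'(1)]
  show "X \<otimes>\<^bsub>Q\<^esub> Y \<otimes>\<^bsub>Q\<^esub> Z = X \<otimes>\<^bsub>Q\<^esub> (Y \<otimes>\<^bsub>Q\<^esub> Z)"
    by (simp add: mult_difference order_ideal_set_mult in_set_mult ideal_mult_assoc m_assoc)
next
  fix X assume "X \<in> carrier Q"
  then obtain I a b where X: "order_ideal G I" "a \<in> I" "b \<in> I" "X = difference G I a b"
    by (rule carrier_envelopeE)
  have "Units G \<subseteq> I"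
    using unit_divides order_idealD(2,3,5)[OF X(1)] Units_closed by (meson subsetI)
  then have "Units G <#> I = I"
    using set_mult_absorb[OF order_ideal_Units X(1)] by blast
  moreover have "\<one>\<^bsub>Q\<^esub> = difference G (Units G) \<one> \<one>" by (simp add: clifford_envelope_def)
  ultimately show "\<one>\<^bsub>Q\<^esub> \<otimes>\<^bsub>Q\<^esub> X = X"
    using X order_idealD(3)[OF X(1)] order_ideal_Units by (simp add: mult_difference)
qed

lemma inverse_monoid_envelope: "inverse_monoid Q"
proof -
  interpret Q: comm_monoid Q by (rule comm_monoid_envelope)
  show ?thesis
  proof (rule Q.inverse_monoidI)
    fix X assume "X \<in> carrier Q"
    then obtain I a b where X: "order_ideal G I" "a \<in> I" "b \<in> I" "X = difference G I a b"
      by (rule carrier_envelopeE)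
    note [simp] = order_idealD(3)[OF X(1)] order_idealD(2,4)[OF X(1)]
    have *: "difference G I c d \<otimes>\<^bsub>Q\<^esub> difference G I d c \<otimes>\<^bsub>Q\<^esub> difference G I c d = difference G I c d"
      if "c \<in> I" "d \<in> I" for c d
    proof -
      have "(c, d) \<in> difference G I (c \<otimes> d \<otimes> c) (d \<otimes> c \<otimes> d)"
        using that by (auto simp: difference_def m_ac intro!: bexI[of _ \<one>])
      then show ?thesis
        using that X(1) by (simp add: mult_difference set_mult_idem difference_eq_iff)
    qed
    have "weak_inverse Q X (difference G I b a)"
      unfolding weak_inverse_def using X * by (simp add: carrier_envelopeI)
    then show "\<exists>Y. weak_inverse Q X Y" ..
  qed
qed

definition ideal_idempotent :: "'a set \<Rightarrow> ('a \<times> 'a) set" where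
  "ideal_idempotent I = difference G I \<one> \<one>"

lemma mult_ideal_idempotent:
  "order_ideal G I \<Longrightarrow> order_ideal G J \<Longrightarrow>
    ideal_idempotent I \<otimes>\<^bsub>Q\<^esub> ideal_idempotent J = ideal_idempotent (I <#> J)"
  by (simp add: ideal_idempotent_def mult_difference order_idealD(2))

lemma ideal_idempotent_inject:
  "order_ideal G I \<Longrightarrow> order_ideal G J \<Longrightarrow> ideal_idempotent I = ideal_idempotent J \<longleftrightarrow> I = J"
  by (metis ideal_idempotent_def order_idealD(2) underlying_ideal_difference)

text \<open>
  Doubling keeps the ideal, and in a group only the neutral element is idempotent.
\<close>

lemma idempotents_envelope: "idempotents Q = ideal_idempotent ` {I. order_ideal G I}"
proof (intro subset_antisym subsetI)
  fix X assume "X \<in> idempotents Q"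
  then have "X \<in> carrier Q" and XX: "X \<otimes>\<^bsub>Q\<^esub> X = X" by (auto simp: idempotents_def)
  then obtain I a b where X: "order_ideal G I" "a \<in> I" "b \<in> I" "X = difference G I a b"
    by (elim carrier_envelopeE)
  note [simp] = order_idealD(3)[OF X(1)] order_idealD(2,4)[OF X(1)]
  have "difference G I a b = difference G I (a \<otimes> a) (b \<otimes> b)"
    using XX X by (simp add: mult_difference set_mult_idem)
  then have "(a \<otimes> a, b \<otimes> b) \<in> difference G I a b"
    using X in_difference by simp
  then obtain k where k: "k \<in> I" "a \<otimes> (b \<otimes> b) \<otimes> k = b \<otimes> (a \<otimes> a) \<otimes> k"
    by (auto simp: difference_def)
  then have "a \<otimes> (a \<otimes> b \<otimes> k) = b \<otimes> (a \<otimes> b \<otimes> k)"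
    using X by (simp add: m_ac)
  then have "(\<one>, \<one>) \<in> difference G I a b"
    using X k by (auto simp: difference_def intro!: bexI[of _ "a \<otimes> b \<otimes> k"])
  then have "X = ideal_idempotent I"
    using X by (simp add: ideal_idempotent_def difference_eq_iff)
  then show "X \<in> ideal_idempotent ` {I. order_ideal G I}" using X by blast
next
  fix X assume "X \<in> ideal_idempotent ` {I. order_ideal G I}"
  then obtain I where I: "order_ideal G I" "X = ideal_idempotent I" by blast
  then have "X \<in> carrier Q" 
    by (simp add: ideal_idempotent_def carrier_envelopeI order_idealD(2))
  then show "X \<in> idempotents Q"
    using I by (simp add: idempotents_def mult_ideal_idempotent set_mult_idem)
qed

lemma distributive_lattice_idempotents: "distributive_lattice (idempotent_order Q)"
proof -
  let ?L = "idempotent_order Q"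
  have carrier: "X \<in> carrier ?L \<longleftrightarrow> (\<exists>I. order_ideal G I \<and> X = ideal_idempotent I)" for X
    by (auto simp: idempotent_order_def idempotents_envelope)
  have le: "ideal_idempotent I \<sqsubseteq>\<^bsub>?L\<^esub> ideal_idempotent J \<longleftrightarrow> I \<subseteq> J"
    if "order_ideal G I" "order_ideal G J" for I J
    using that by (simp add: idempotent_order_def mult_ideal_idempotent ideal_idempotent_inject
        order_ideal_set_mult set_mult_absorb)
  interpret L: partial_order ?L
  proof (unfold_locales)
    show eq: "(.=\<^bsub>?L\<^esub>) = (=)" by (simp add: idempotent_order_def)
    fix X assume "X \<in> carrier ?L"
    then show "X \<sqsubseteq>\<^bsub>?L\<^esub> X" "X .=\<^bsub>?L\<^esub> X" by (auto simp: carrier le eq)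
    fix Y assume "Y \<in> carrier ?L"
    with \<open>X \<in> carrier ?L\<close> obtain I J where IJ: "order_ideal G I" "order_ideal G J"
      "X = ideal_idempotent I" "Y = ideal_idempotent J"
      by (auto simp: carrier)
    then show "X .=\<^bsub>?L\<^esub> Y" if "X \<sqsubseteq>\<^bsub>?L\<^esub> Y" "Y \<sqsubseteq>\<^bsub>?L\<^esub> X"
      using that by (simp add: eq le)
    show "Y .=\<^bsub>?L\<^esub> X" if "X .=\<^bsub>?L\<^esub> Y" using that by (simp add: eq)
    fix Z assume "Z \<in> carrier ?L"
    then obtain K where K: "order_ideal G K" "Z = ideal_idempotent K"
      by (auto simp: carrier)
    show "X \<sqsubseteq>\<^bsub>?L\<^esub> Z" if "X \<sqsubseteq>\<^bsub>?L\<^esub> Y" "Y \<sqsubseteq>\<^bsub>?L\<^esub> Z"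
      using that IJ K by (simp add: le)
    show "X .=\<^bsub>?L\<^esub> Z" if "X .=\<^bsub>?L\<^esub> Y" "Y .=\<^bsub>?L\<^esub> Z" using that by (simp add: eq)
    fix W
    show "X \<sqsubseteq>\<^bsub>?L\<^esub> Z \<longleftrightarrow> Y \<sqsubseteq>\<^bsub>?L\<^esub> W" if "X .=\<^bsub>?L\<^esub> Y" "Z .=\<^bsub>?L\<^esub> W"
      using that by (simp add: eq)
  qed
  have sup: "least ?L (ideal_idempotent (I <#> J)) (Upper ?L {ideal_idempotent I, ideal_idempotent J})"
    if I: "order_ideal G I" and J: "order_ideal G J" for I J
  proof (rule least_UpperI)
    fix X assume "X \<in> {ideal_idempotent I, ideal_idempotent J}"
    then show "X \<sqsubseteq>\<^bsub>?L\<^esub> ideal_idempotent (I <#> J)"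
      using I J by (auto simp: le order_ideal_set_mult subset_set_mult_left subset_set_mult_right)
  next
    fix X assume X: "X \<in> Upper ?L {ideal_idempotent I, ideal_idempotent J}"
    then have "X \<in> carrier ?L" by (simp add: Upper_def)
    then obtain K where K: "order_ideal G K" "X = ideal_idempotent K" by (auto simp: carrier)
    have "ideal_idempotent I \<sqsubseteq>\<^bsub>?L\<^esub> X" "ideal_idempotent J \<sqsubseteq>\<^bsub>?L\<^esub> X"
      using X I J carrier by (auto simp: Upper_def)
    then show "ideal_idempotent (I <#> J) \<sqsubseteq>\<^bsub>?L\<^esub> X"
      using I J K by (simp add: le order_ideal_set_mult set_mult_subset)
  qed (use I J order_ideal_set_mult carrier in auto)
  have inf: "greatest ?L (ideal_idempotent (I \<inter> J)) (Lower ?L {ideal_idempotent I, ideal_idempotent J})"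
    if I: "order_ideal G I" and J: "order_ideal G J" for I J
  proof (rule greatest_LowerI)
    fix X assume "X \<in> {ideal_idempotent I, ideal_idempotent J}"
    then show "ideal_idempotent (I \<inter> J) \<sqsubseteq>\<^bsub>?L\<^esub> X"
      using I J by (auto simp: le order_ideal_Int)
  next
    fix X assume X: "X \<in> Lower ?L {ideal_idempotent I, ideal_idempotent J}"
    then have "X \<in> carrier ?L" by (simp add: Lower_def)
    then obtain K where K: "order_ideal G K" "X = ideal_idempotent K" by (auto simp: carrier)
    have "X \<sqsubseteq>\<^bsub>?L\<^esub> ideal_idempotent I" "X \<sqsubseteq>\<^bsub>?L\<^esub> ideal_idempotent J"
      using X I J carrier by (auto simp: Lower_def)
    then show "X \<sqsubseteq>\<^bsub>?L\<^esub> ideal_idempotent (I \<inter> J)"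
      using I J K by (simp add: le order_ideal_Int)
  qed (use I J order_ideal_Int carrier in auto)
  interpret L: lattice ?L
  proof
    fix X Y assume "X \<in> carrier ?L" "Y \<in> carrier ?L"
    then obtain I J where "order_ideal G I" "order_ideal G J"
      "X = ideal_idempotent I" "Y = ideal_idempotent J"
      by (auto simp: carrier)
    then show "\<exists>s. least ?L s (Upper ?L {X, Y})" "\<exists>s. greatest ?L s (Lower ?L {X, Y})"
      using sup inf by blast+
  qed
  have join: "ideal_idempotent I \<squnion>\<^bsub>?L\<^esub> ideal_idempotent J = ideal_idempotent (I <#> J)"
    if "order_ideal G I" "order_ideal G J" for I J
  proof (rule L.joinI)
    show "X = ideal_idempotent (I <#> J)"
      if "least ?L X (Upper ?L {ideal_idempotent I, ideal_idempotent J})" for X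
      using L.least_unique[OF that sup] \<open>order_ideal G I\<close> \<open>order_ideal G J\<close> by blast
  qed (use that carrier in blast)+
  have meet: "ideal_idempotent I \<sqinter>\<^bsub>?L\<^esub> ideal_idempotent J = ideal_idempotent (I \<inter> J)"
    if "order_ideal G I" "order_ideal G J" for I J
  proof (rule L.meetI)
    show "X = ideal_idempotent (I \<inter> J)"
      if "greatest ?L X (Lower ?L {ideal_idempotent I, ideal_idempotent J})" for X
      using L.greatest_unique[OF that inf] \<open>order_ideal G I\<close> \<open>order_ideal G J\<close> by blast
  qed (use that carrier in blast)+
  show ?thesis
  proof
    fix X Y Z assume "X \<in> carrier ?L" "Y \<in> carrier ?L" "Z \<in> carrier ?L"
    then obtain I J K where "order_ideal G I" "order_ideal G J" "order_ideal G K"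
      "X = ideal_idempotent I" "Y = ideal_idempotent J" "Z = ideal_idempotent K"
      by (auto simp: carrier)
    then show "X \<sqinter>\<^bsub>?L\<^esub> (Y \<squnion>\<^bsub>?L\<^esub> Z) = (X \<sqinter>\<^bsub>?L\<^esub> Y) \<squnion>\<^bsub>?L\<^esub> (X \<sqinter>\<^bsub>?L\<^esub> Z)"
      by (simp add: join meet order_ideal_set_mult order_ideal_Int ideal_distrib)
  qed
qed

end

text \<open>
  The natural partial order of an inverse monoid, read upwards so that adding an idempotent
  makes an element larger.
\<close>

definition natural_order :: "('a, 'm) monoid_scheme \<Rightarrow> 'a \<Rightarrow> 'a \<Rightarrow> bool" where
  "natural_order G x y \<longleftrightarrow> (\<exists>e\<in>idempotents G. y = x \<otimes>\<^bsub>G\<^esub> e)"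

lemma idempotentsD:
  assumes "e \<in> idempotents G"
  shows "e \<in> carrier G" "e \<otimes>\<^bsub>G\<^esub> e = e"
  using assms by (auto simp: idempotents_def)

context comm_monoid
begin

lemma idempotents_mult:
  assumes "e \<in> idempotents G" "f \<in> idempotents G"
  shows "e \<otimes> f \<in> idempotents G"
proof -
  note e = idempotentsD[OF assms(1)] idempotentsD[OF assms(2)]
  have "e \<otimes> f \<otimes> (e \<otimes> f) = (e \<otimes> e) \<otimes> (f \<otimes> f)"
    using e(1,3) by (simp only: m_ac m_closed)
  then show ?thesis using e by (simp add: idempotents_def)
qed

lemma natural_order_idempotents:
  assumes "e \<in> idempotents G" "f \<in> idempotents G"
  shows "natural_order G e f \<longleftrightarrow> e \<otimes> f = f"
proof
  assume "natural_order G e f"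
  then obtain g where "g \<in> carrier G" "f = e \<otimes> g"
    by (auto simp: natural_order_def dest: idempotentsD)
  then show "e \<otimes> f = f" using idempotentsD[OF assms(1)] by (metis m_assoc)
qed (metis assms(2) natural_order_def)

lemma partially_ordered_natural: "partially_ordered_comm_monoid G (natural_order G)"
proof (intro partially_ordered_comm_monoid.intro partially_ordered_comm_monoid_axioms.intro)
  show "comm_monoid G" by (rule comm_monoid_axioms)
next
  fix x y z assume c: "x \<in> carrier G" "y \<in> carrier G" "z \<in> carrier G" and "natural_order G x y"
  then obtain e where "e \<in> idempotents G" "y = x \<otimes> e" "e \<in> carrier G"
    by (auto simp: natural_order_def dest: idempotentsD)
  moreover from this c have "y \<otimes> z = x \<otimes> z \<otimes> e" by (simp add: m_ac)
  ultimately show "natural_order G (x \<otimes> z) (y \<otimes> z)" by (auto simp: natural_order_def)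
next
  show "partial_order \<lparr>carrier = carrier G, eq = (=), le = natural_order G\<rparr>"
  proof (unfold_locales, simp_all)
    have "\<one> \<in> idempotents G" by (simp add: idempotents_def)
    then show "natural_order G x x" if "x \<in> carrier G" for x
      unfolding natural_order_def using that by (intro bexI[of _ \<one>]) simp
  next
    fix x y z assume c: "x \<in> carrier G" "y \<in> carrier G" "z \<in> carrier G"
      and "natural_order G x y" "natural_order G y z"
    then obtain e f where e: "e \<in> idempotents G" "f \<in> idempotents G" "y = x \<otimes> e" "z = y \<otimes> f"
      by (auto simp: natural_order_def)
    then have "z = x \<otimes> (e \<otimes> f)" using c by (simp add: m_assoc idempotentsD(1))
    then show "natural_order G x z"
      unfolding natural_order_def using idempotents_mult[OF e(1,2)] by blast
  next
    fix x y assume c: "x \<in> carrier G" "y \<in> carrier G" and "natural_order G x y" "natural_order G y x"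
    then obtain e f where e: "e \<in> idempotents G" "f \<in> idempotents G" "y = x \<otimes> e" "x = y \<otimes> f"
      by (auto simp: natural_order_def)
    note e' = idempotentsD[OF e(1)] idempotentsD[OF e(2)]
    have "y \<otimes> e = y" using c e' unfolding e(3) by (simp add: m_assoc)
    then have "x \<otimes> e = x" using c e(4) e' by (metis m_assoc m_comm)
    then show "x = y" using e(3) by simp
  qed
qed

end

text \<open>
  The order ideal generated by \<open>a\<close>, see \<open>principal_ideal_subset_iff\<close>.
\<close>

definition (in monoid) principal_ideal :: "'a \<Rightarrow> 'a set" where
  "principal_ideal a = {c \<in> carrier G. \<exists>n::nat. c divides a [^] n}"

context refinement_monoid
begin

lemma order_ideal_principal:
  assumes a: "a \<in> carrier G"
  shows "order_ideal G (principal_ideal a)"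
  unfolding order_ideal_def principal_ideal_def
proof (intro conjI ballI impI; clarsimp)
  show "\<exists>n::nat. \<one> divides a [^] n" using divides_refl[of \<one>] by (intro exI[of _ 0]) simp
next
  fix c d :: 'a and m n :: nat
  assume cd: "c \<in> carrier G" "d \<in> carrier G" "c divides a [^] m" "d divides a [^] n"
  then obtain c' d' where "c' \<in> carrier G" "d' \<in> carrier G" "a [^] m = c \<otimes> c'" "a [^] n = d \<otimes> d'"
    by (meson dividesE)
  then have "a [^] (m + n) = (c \<otimes> d) \<otimes> (c' \<otimes> d')"
    using a cd by (simp add: nat_pow_mult[symmetric] m_ac)
  then have "c \<otimes> d divides a [^] (m + n)"
    using \<open>c' \<in> carrier G\<close> \<open>d' \<in> carrier G\<close> by (intro dividesI[of "c' \<otimes> d'"]) auto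
  then show "\<exists>n::nat. c \<otimes> d divides a [^] n" ..
next
  fix c d and n :: nat
  assume "c \<in> carrier G" "d \<in> carrier G" "d divides c" "c divides a [^] n"
  then show "\<exists>n::nat. d divides a [^] n" by (meson divides_trans)
qed

lemma in_principal_ideal: "a \<in> carrier G \<Longrightarrow> a \<in> principal_ideal a"
  unfolding principal_ideal_def using divides_refl by (auto intro!: exI[of _ "1::nat"])

lemma principal_ideal_subset_iff:
  assumes "order_ideal G I" "a \<in> carrier G"
  shows "principal_ideal a \<subseteq> I \<longleftrightarrow> a \<in> I"
proof
  assume a: "a \<in> I"
  have "a [^] n \<in> I" for n :: nat
    by (induction n) (use assms a in \<open>auto intro: order_idealD\<close>)
  then show "principal_ideal a \<subseteq> I"
    using assms(1) by (auto simp: principal_ideal_def intro: order_idealD(5))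
qed (use in_principal_ideal assms in auto)

text \<open>
  Both sides are the least order ideal that contains \<open>a\<close> and \<open>b\<close>.
\<close>

lemma principal_ideal_mult:
  assumes a: "a \<in> carrier G" "b \<in> carrier G"
  shows "principal_ideal (a \<otimes> b) = principal_ideal a <#> principal_ideal b"
proof
  note ideals = order_ideal_principal[OF a(1)] order_ideal_principal[OF a(2)]
  show "principal_ideal (a \<otimes> b) \<subseteq> principal_ideal a <#> principal_ideal b"
    using a in_principal_ideal
    by (subst principal_ideal_subset_iff) (simp_all add: order_ideal_set_mult ideals in_set_mult)
  have ab: "order_ideal G (principal_ideal (a \<otimes> b))" "a \<otimes> b \<in> principal_ideal (a \<otimes> b)"
    using a by (auto intro: order_ideal_principal in_principal_ideal)
  have "a divides a \<otimes> b" "b divides a \<otimes> b" using a m_comm by (auto intro: dividesI)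
  then have "a \<in> principal_ideal (a \<otimes> b)" "b \<in> principal_ideal (a \<otimes> b)"
    using a order_idealD(5)[OF ab] by blast+
  then show "principal_ideal a <#> principal_ideal b \<subseteq> principal_ideal (a \<otimes> b)"
    using a ab by (intro set_mult_subset) (simp_all add: principal_ideal_subset_iff)
qed

lemma principal_ideal_one: "principal_ideal \<one> = Units G"
  unfolding principal_ideal_def using Unit_eq_dividesone Units_closed by auto

end

context countable_sum_monoid
begin

definition envelope_class :: "'a \<Rightarrow> ('a \<times> 'a) set" where
  "envelope_class a = difference G (principal_ideal a) a \<one>"

text \<open>
  If the differences \<open>a - 0\<close> and \<open>b - 0\<close> agree, then \<open>a\<close> and \<open>b\<close> generate the same ideal and
  \<open>a + k = b + k\<close> for some \<open>k\<close> in it; such a \<open>k\<close> is below multiples of \<open>a\<close> and of \<open>b\<close>, and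
  cancels.
\<close>

lemma embedding_envelope: "monoid_embedding envelope_class G Q"
  unfolding monoid_embedding_def envelope_class_def
proof (intro conjI homI inj_onI)
  note ideal = order_ideal_principal in_principal_ideal order_idealD(2)[OF order_ideal_principal]
  show "difference G (principal_ideal a) a \<one> \<in> carrier Q" if "a \<in> carrier G" for a
    using that by (intro carrier_envelopeI ideal)
  show "difference G (principal_ideal (a \<otimes> b)) (a \<otimes> b) \<one> =
      difference G (principal_ideal a) a \<one> \<otimes>\<^bsub>Q\<^esub> difference G (principal_ideal b) b \<one>"
    if "a \<in> carrier G" "b \<in> carrier G" for a b
    using that by (simp add: mult_difference ideal principal_ideal_mult)
  show "difference G (principal_ideal \<one>) \<one> \<one> = \<one>\<^bsub>Q\<^esub>"
    by (simp add: clifford_envelope_def principal_ideal_one)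
next
  fix a b assume ab: "a \<in> carrier G" "b \<in> carrier G"
    and eq: "difference G (principal_ideal a) a \<one> = difference G (principal_ideal b) b \<one>"
  note ideal = order_ideal_principal in_principal_ideal order_idealD(2)[OF order_ideal_principal]
  have I: "principal_ideal a = principal_ideal b"
    using eq underlying_ideal_difference[of "principal_ideal a" a \<one>]
      underlying_ideal_difference[of "principal_ideal b" b \<one>] ab ideal by simp
  then have "(b, \<one>) \<in> difference G (principal_ideal a) a \<one>"
    using eq in_difference[of "principal_ideal b" b \<one>] ab ideal by simp
  then obtain k where k: "k \<in> principal_ideal a" "a \<otimes> k = b \<otimes> k"
    using ab by (auto simp: difference_def)
  from k(1) obtain n :: nat where "k divides a [^] n" "k \<in> carrier G"
    by (auto simp: principal_ideal_def)
  moreover from k(1) obtain m :: nat where "k divides b [^] m"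
    unfolding I by (auto simp: principal_ideal_def)
  ultimately show "a = b" using separative k(2) ab by blast
qed

end

section \<open>Commuting idempotents in inverse monoids\<close>

context inverse_monoid
begin

lemma weak_inverseE:
  assumes "s \<in> carrier G"
  obtains t where "t \<in> carrier G" "s \<otimes> t \<otimes> s = s" "t \<otimes> s \<otimes> t = t"
  using unique_weak_inverse[OF assms] by (auto simp: weak_inverse_def)

lemma weak_inverse_unique:
  assumes "weak_inverse G s t" "weak_inverse G s u" "s \<in> carrier G"
  shows "t = u"
  using unique_weak_inverse[OF assms(3)] assms(1,2) by blast

text \<open>
  If \<open>a\<close> is the weak inverse of \<open>e f\<close>, then so is \<open>f a e\<close>; hence \<open>a = f a e\<close>, which makes \<open>a\<close>
  idempotent. Now \<open>a\<close> and \<open>e f\<close> are both weak inverses of \<open>a\<close>, so \<open>e f = a\<close>.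
\<close>

lemma idempotent_mult:
  assumes e: "e \<in> carrier G" "e \<otimes> e = e" and f: "f \<in> carrier G" "f \<otimes> f = f"
  shows "e \<otimes> f \<otimes> (e \<otimes> f) = e \<otimes> f"
proof -
  have e': "e \<otimes> (e \<otimes> x) = e \<otimes> x" and f': "f \<otimes> (f \<otimes> x) = f \<otimes> x" if "x \<in> carrier G" for x
    using that e f by (metis m_assoc)+
  obtain a where a: "a \<in> carrier G" "e \<otimes> f \<otimes> a \<otimes> (e \<otimes> f) = e \<otimes> f" "a \<otimes> (e \<otimes> f) \<otimes> a = a"
    using weak_inverseE[of "e \<otimes> f"] e f by blast
  have a2: "e \<otimes> (f \<otimes> (a \<otimes> (e \<otimes> f))) = e \<otimes> f" and a3: "a \<otimes> (e \<otimes> (f \<otimes> a)) = a"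
    using a e f by (simp_all add: m_assoc)
  have "weak_inverse G (e \<otimes> f) (f \<otimes> a \<otimes> e)"
    unfolding weak_inverse_def
  proof (intro conjI)
    show "e \<otimes> f \<otimes> (f \<otimes> a \<otimes> e) \<otimes> (e \<otimes> f) = e \<otimes> f"
      using a(1) e(1) f(1) by (simp add: m_assoc e' f' a2)
    have "f \<otimes> a \<otimes> e \<otimes> (e \<otimes> f) \<otimes> (f \<otimes> a \<otimes> e) = f \<otimes> (a \<otimes> (e \<otimes> (f \<otimes> a))) \<otimes> e"
      using a(1) e(1) f(1) by (simp add: m_assoc e' f')
    then show "f \<otimes> a \<otimes> e \<otimes> (e \<otimes> f) \<otimes> (f \<otimes> a \<otimes> e) = f \<otimes> a \<otimes> e"
      by (simp add: a3)
  qed (use a e f in auto)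
  moreover have "weak_inverse G (e \<otimes> f) a"
    using a by (simp add: weak_inverse_def)
  ultimately have fae: "f \<otimes> a \<otimes> e = a"
    using weak_inverse_unique e f by blast
  have "a \<otimes> a = f \<otimes> (a \<otimes> (e \<otimes> (f \<otimes> a))) \<otimes> e"
    using a(1) e(1) f(1) by (subst (1 2) fae[symmetric]) (simp add: m_assoc)
  then have aa: "a \<otimes> a = a" by (simp add: a3 fae)
  have "weak_inverse G a (e \<otimes> f)" "weak_inverse G a a"
    using a e f aa by (auto simp: weak_inverse_def)
  then have "e \<otimes> f = a" using weak_inverse_unique a(1) by blast
  then show ?thesis using aa by simp
qed

text \<open>
  Since \<open>e f\<close> and \<open>f e\<close> are idempotent, both are weak inverses of \<open>e f\<close>.
\<close>

lemma idempotents_commute: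
  assumes e: "e \<in> carrier G" "e \<otimes> e = e" and f: "f \<in> carrier G" "f \<otimes> f = f"
  shows "e \<otimes> f = f \<otimes> e"
proof -
  have e': "e \<otimes> (e \<otimes> x) = e \<otimes> x" and f': "f \<otimes> (f \<otimes> x) = f \<otimes> x" if "x \<in> carrier G" for x
    using that e f by (metis m_assoc)+
  have ef: "e \<otimes> (f \<otimes> (e \<otimes> f)) = e \<otimes> f" and fe: "f \<otimes> (e \<otimes> (f \<otimes> e)) = f \<otimes> e"
    using idempotent_mult[OF e f] idempotent_mult[OF f e] e(1) f(1) by (simp_all add: m_assoc)
  have "weak_inverse G (e \<otimes> f) (f \<otimes> e)"
    using e f by (simp add: weak_inverse_def m_assoc e' f' ef fe)
  moreover have "weak_inverse G (e \<otimes> f) (e \<otimes> f)"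
    using e f by (simp add: weak_inverse_def m_assoc ef)
  ultimately show ?thesis
    using weak_inverse_unique e f by blast
qed

end

section \<open>Families of sets and their multiplicities\<close>

text \<open>
  A family of sets stands for the coproduct of its members. Up to identification only the
  cardinality of the fibres matters, so index sets may be reorganised freely.
\<close>

definition fibre :: "('i \<Rightarrow> 'x set) \<Rightarrow> 'x \<Rightarrow> 'i set" where
  "fibre P x = {i. x \<in> P i}"

definition same_multiplicity :: "('i \<Rightarrow> 'x set) \<Rightarrow> ('j \<Rightarrow> 'x set) \<Rightarrow> bool"  (infix \<open>\<doteq>\<close> 50) where
  "P \<doteq> Q \<longleftrightarrow> (\<forall>x. fibre P x \<approx> fibre Q x)"

text \<open>
  The double family \<open>R\<close> refines \<open>P\<close> member by member; the uncurried family \<open>case_prod R\<close> is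
  then another form of the same coproduct.
\<close>

definition is_partition :: "('i \<Rightarrow> 'x set) \<Rightarrow> ('i \<Rightarrow> 'j \<Rightarrow> 'x set) \<Rightarrow> bool" where
  "is_partition P R \<longleftrightarrow> (\<forall>i. disjoint_family (R i) \<and> P i = (\<Union>j. R i j))"

lemma same_multiplicityI: "(\<And>x. fibre P x \<approx> fibre Q x) \<Longrightarrow> P \<doteq> Q"
  by (simp add: same_multiplicity_def)

lemma same_multiplicityD: "P \<doteq> Q \<Longrightarrow> fibre P x \<approx> fibre Q x"
  by (simp add: same_multiplicity_def)

lemma same_multiplicity_bij: "(\<And>x. bij_betw f (fibre P x) (fibre Q x)) \<Longrightarrow> P \<doteq> Q"
  unfolding same_multiplicity_def eqpoll_def by blast

lemma same_multiplicity_refl [simp]: "P \<doteq> P"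
  by (simp add: same_multiplicity_def)

lemma same_multiplicity_sym: "P \<doteq> Q \<Longrightarrow> Q \<doteq> P"
  by (simp add: same_multiplicity_def eqpoll_sym)

lemma same_multiplicity_trans [trans]: "P \<doteq> Q \<Longrightarrow> Q \<doteq> R \<Longrightarrow> P \<doteq> R"
  unfolding same_multiplicity_def by (blast intro: eqpoll_trans)

lemma is_partitionD:
  assumes "is_partition P R"
  shows "P i = (\<Union>j. R i j)" "x \<in> R i j \<Longrightarrow> x \<in> R i k \<Longrightarrow> j = k"
  using assms unfolding is_partition_def disjoint_family_on_def by blast+

lemma same_multiplicity_partition:
  assumes "is_partition P R"
  shows "P \<doteq> case_prod R"
proof (rule same_multiplicity_sym, rule same_multiplicity_bij)
  fix x
  show "bij_betw fst (fibre (case_prod R) x) (fibre P x)"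
    unfolding bij_betw_def inj_on_def fibre_def
    using is_partitionD(1)[OF assms] is_partitionD(2)[OF assms] by (auto simp: image_iff)
qed

lemma same_multiplicity_swap: "case_prod R \<doteq> case_prod (\<lambda>j i. R i j)"
  by (rule same_multiplicity_bij[where f = prod.swap]) (force simp: bij_betw_def inj_on_def fibre_def)

lemma fibre_case_prod: "fibre (case_prod P) x = (SIGMA i:UNIV. fibre (P i) x)"
  by (auto simp: fibre_def)

lemma same_multiplicity_case_prod:
  assumes "\<And>i. P i \<doteq> Q i"
  shows "case_prod P \<doteq> case_prod Q"
proof (rule same_multiplicityI)
  fix x
  show "fibre (case_prod P) x \<approx> fibre (case_prod Q) x"
    unfolding fibre_case_prod
    by (rule Sigma_eqpoll_cong[of id UNIV UNIV, simplified])
      (use assms in \<open>auto simp: same_multiplicity_def\<close>)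
qed

text \<open>
  The rank of \<open>k\<close> in \<open>V\<close> is the number of smaller elements of \<open>V\<close>.
\<close>

lemma exists_rank:
  fixes V :: "nat set"
  assumes "infinite V \<or> n < card V"
  shows "\<exists>k\<in>V. card (V \<inter> {..<k}) = n"
  using assms
proof (induction n)
  case 0
  then have "\<exists>k. k \<in> V" by (metis all_not_in_conv card.empty finite.emptyI less_irrefl)
  then have "(LEAST k. k \<in> V) \<in> V" "V \<inter> {..<(LEAST k. k \<in> V)} = {}"
    by (auto intro: LeastI dest: not_less_Least)
  then show ?case by (metis card.empty)
next
  case (Suc n)
  then obtain k where k: "k \<in> V" "card (V \<inter> {..<k}) = n" by force
  have *: "V \<inter> {..<Suc k} = insert k (V \<inter> {..<k})" using k(1) by (auto simp: less_Suc_eq)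
  then have card: "card (V \<inter> {..<Suc k}) = Suc n" using k(2) by simp
  have "\<exists>l. l \<in> V \<and> k < l"
  proof (rule ccontr)
    assume "\<not> ?thesis"
    then have "V = V \<inter> {..<Suc k}" by (auto simp: less_Suc_eq_le not_less)
    then show False using Suc.prems card by (metis finite_Int finite_lessThan less_irrefl)
  qed
  then have l: "(LEAST l. l \<in> V \<and> k < l) \<in> V \<and> k < (LEAST l. l \<in> V \<and> k < l)" (is "?l \<in> V \<and> _")
    by (rule LeastI_ex)
  have "V \<inter> {..<?l} = V \<inter> {..<Suc k}"
    using l not_less_Least[of _ "\<lambda>l. l \<in> V \<and> k < l"] by (auto simp: less_Suc_eq_le) (meson not_le)
  then show ?case using l card by metis
qed

lemma rank_strict_mono:
  fixes V :: "nat set"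
  assumes "k \<in> V" "k < l"
  shows "card (V \<inter> {..<k}) < card (V \<inter> {..<l})"
  by (rule psubset_card_mono) (use assms in auto)

lemma rank_inject:
  fixes V :: "nat set"
  assumes "k \<in> V" "l \<in> V" "card (V \<inter> {..<k}) = card (V \<inter> {..<l})"
  shows "k = l"
  using rank_strict_mono[of k V l] rank_strict_mono[of l V k] assms by (cases k l rule: linorder_cases) auto

lemma equal_rank:
  fixes U V :: "nat set"
  assumes "U \<approx> V" "u \<in> U"
  shows "\<exists>v\<in>V. card (U \<inter> {..<u}) = card (V \<inter> {..<v})"
proof -
  have "infinite V \<or> card (U \<inter> {..<u}) < card V"
  proof (rule disjCI)
    assume "\<not> card (U \<inter> {..<u}) < card V"
    moreover have "card (U \<inter> {..<u}) < card U" if "finite U"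
      by (rule psubset_card_mono) (use that assms in auto)
    moreover have "card U = card V" using assms(1) by (metis bij_betw_same_card eqpoll_def)
    ultimately show "infinite V" using eqpoll_finite_iff[OF assms(1)] by auto
  qed
  from exists_rank[OF this] show ?thesis by metis
qed

text \<open>
  Matching members of two equinumerous fibres must be done measurably, without
  choosing a bijection for each point. Indices are matched by rank: \<open>R i j\<close> consists of the
  points \<open>x\<close> of \<open>P i \<inter> Q j\<close> for which \<open>i\<close> and \<open>j\<close> have the same rank in the fibres over \<open>x\<close>.
\<close>

lemma common_refinement:
  fixes P :: "'i::countable \<Rightarrow> 'x set" and Q :: "'j::countable \<Rightarrow> 'x set"
  assumes PQ: "P \<doteq> Q" and P: "\<And>i. P i \<in> sets M" and Q: "\<And>j. Q j \<in> sets M"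
  obtains R where "\<And>i j. R i j \<in> sets M" "is_partition P R" "is_partition Q (\<lambda>j i. R i j)"
proof -
  define U where "U x = to_nat ` fibre P x" for x
  define V where "V x = to_nat ` fibre Q x" for x
  have UV: "U x \<approx> V x" for x
    using same_multiplicityD[OF PQ, of x] by (simp add: U_def V_def)
  have U: "to_nat i \<in> U x \<longleftrightarrow> x \<in> P i" for i x by (auto simp: U_def fibre_def)
  have V: "to_nat j \<in> V x \<longleftrightarrow> x \<in> Q j" for j x by (auto simp: V_def fibre_def)
  define R where "R i j = {x \<in> space M. x \<in> P i \<and> x \<in> Q j \<and>
      card (U x \<inter> {..<to_nat i}) = card (V x \<inter> {..<to_nat j})}" for i j
  have sub: "P i \<subseteq> space M" "Q j \<subseteq> space M" for i j
    using sets.sets_into_space[OF P] sets.sets_into_space[OF Q] by blast+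
  show thesis
  proof (rule that[of R])
    fix i :: 'i and j :: 'j
    have [measurable]: "{x \<in> space M. n \<in> U x \<inter> {..<k}} \<in> sets M" for n k
    proof -
      have "{x \<in> space M. n \<in> U x \<inter> {..<k}} = (if n < k then \<Union>i\<in>{i. to_nat i = n}. P i else {})"
        using sub by (auto simp: U_def fibre_def)
      then show ?thesis using P by auto
    qed
    have [measurable]: "{x \<in> space M. n \<in> V x \<inter> {..<k}} \<in> sets M" for n k
    proof -
      have "{x \<in> space M. n \<in> V x \<inter> {..<k}} = (if n < k then \<Union>i\<in>{i. to_nat i = n}. Q i else {})"
        using sub by (auto simp: V_def fibre_def)
      then show ?thesis using Q by auto
    qed
    note [measurable] = P Q
    have [measurable]: "(\<lambda>x. card (U x \<inter> {..<to_nat i})) \<in> measurable M (count_space UNIV)"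
      "(\<lambda>x. card (V x \<inter> {..<to_nat j})) \<in> measurable M (count_space UNIV)"
      by (rule measurable_card, measurable)+
    show "R i j \<in> sets M"
      unfolding R_def by measurable
  next
    show "is_partition P R"
      unfolding is_partition_def
    proof (intro allI conjI)
      fix i
      have "j = k" if "x \<in> R i j" "x \<in> R i k" for x j k
        using that rank_inject[of "to_nat j" "V x" "to_nat k"] by (simp add: R_def V)
      then show "disjoint_family (R i)"
        unfolding disjoint_family_on_def by blast
      have "\<exists>j. x \<in> R i j" if x: "x \<in> P i" for x
      proof -
        obtain v where v: "v \<in> V x" "card (U x \<inter> {..<to_nat i}) = card (V x \<inter> {..<v})"
          using equal_rank[OF UV, of "to_nat i" x] U x by blast
        then obtain j where "v = to_nat j" "x \<in> Q j" by (auto simp: V_def fibre_def)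
        then show ?thesis using v x sub by (auto simp: R_def)
      qed
      then show "P i = (\<Union>j. R i j)" by (auto simp: R_def)
    qed
    show "is_partition Q (\<lambda>j i. R i j)"
      unfolding is_partition_def
    proof (intro allI conjI)
      fix j
      have "i = k" if "x \<in> R i j" "x \<in> R k j" for x i k
        using that rank_inject[of "to_nat i" "U x" "to_nat k"] by (simp add: R_def U)
      then show "disjoint_family (\<lambda>i. R i j)"
        unfolding disjoint_family_on_def by blast
      have "\<exists>i. x \<in> R i j" if x: "x \<in> Q j" for x
      proof -
        obtain u where u: "u \<in> U x" "card (V x \<inter> {..<to_nat j}) = card (U x \<inter> {..<u})"
          using equal_rank[OF eqpoll_sym[OF UV], of "to_nat j" x] V x by blast
        then obtain i where "u = to_nat i" "x \<in> P i" by (auto simp: U_def fibre_def)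
        then show ?thesis using u x sub by (auto simp: R_def)
      qed
      then show "Q j = (\<Union>i. R i j)" by (auto simp: R_def)
    qed
  qed
qed

lemma same_coproduct_is_partition:
  "same_coproduct M P Q \<longleftrightarrow>
    (\<exists>R. (\<forall>j k. R j k \<in> sets M) \<and> is_partition P R \<and> is_partition Q (\<lambda>k j. R j k))"
  by (simp add: same_coproduct_def is_partition_def)

lemma same_coproduct_iff:
  assumes "P \<in> coproducts M" "Q \<in> coproducts M"
  shows "same_coproduct M P Q \<longleftrightarrow> P \<doteq> Q"
proof
  assume "same_coproduct M P Q"
  then obtain R where R: "is_partition P R" "is_partition Q (\<lambda>j i. R i j)"
    unfolding same_coproduct_is_partition by metis
  show "P \<doteq> Q"
    using same_multiplicity_trans[OF same_multiplicity_partition[OF R(1)]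
        same_multiplicity_trans[OF same_multiplicity_swap
          same_multiplicity_sym[OF same_multiplicity_partition[OF R(2)]]]] .
next
  assume PQ: "P \<doteq> Q"
  have "P j \<in> sets M" "Q j \<in> sets M" for j
    using assms by (simp_all add: coproducts_def)
  then show "same_coproduct M P Q"
    unfolding same_coproduct_is_partition by (rule common_refinement[OF PQ]) blast+
qed

definition sequence_of :: "('i::countable \<Rightarrow> 'x set) \<Rightarrow> nat \<Rightarrow> 'x set" where
  "sequence_of A n = (if n \<in> range (to_nat :: 'i \<Rightarrow> nat) then A (from_nat n) else {})"

lemma sequence_of_same: "A \<doteq> sequence_of A"
  by (rule same_multiplicity_bij[where f = to_nat])
    (auto simp: bij_betw_def fibre_def sequence_of_def image_iff)

lemma countable_coproduct_same: "countable_coproduct P \<doteq> case_prod P"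
proof (rule same_multiplicity_bij)
  fix x
  show "bij_betw prod_decode (fibre (countable_coproduct P) x) (fibre (case_prod P) x)"
    by (rule bij_betw_byWitness[where f' = prod_encode])
      (auto simp: fibre_def countable_coproduct_def split: prod.splits)
qed

lemma coproduct2_closed: "P \<in> coproducts M \<Longrightarrow> Q \<in> coproducts M \<Longrightarrow> coproduct2 P Q \<in> coproducts M"
  by (auto simp: coproducts_def coproduct2_def split: sum.splits)

lemma countable_coproduct_closed: "(\<And>n. P n \<in> coproducts M) \<Longrightarrow> countable_coproduct P \<in> coproducts M"
  by (auto simp: coproducts_def countable_coproduct_def split: prod.splits)

lemma empty_coproduct_closed: "empty_coproduct \<in> coproducts M"
  by (auto simp: coproducts_def empty_coproduct_def)

lemma fibre_coproduct2: "fibre (coproduct2 P Q) x \<approx> fibre P x <+> fibre Q x"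
proof -
  have "fibre (coproduct2 P Q) x = sum_encode ` (fibre P x <+> fibre Q x)"
  proof (intro subset_antisym subsetI)
    fix n assume "n \<in> fibre (coproduct2 P Q) x"
    then have "sum_decode n \<in> fibre P x <+> fibre Q x"
      by (auto simp: fibre_def coproduct2_def split: sum.splits)
    then show "n \<in> sum_encode ` (fibre P x <+> fibre Q x)"
      by (metis image_eqI sum_decode_inverse)
  qed (auto simp: fibre_def coproduct2_def)
  then show ?thesis by (simp add: inj_on_image_eqpoll_self inj_sum_encode)
qed

lemma Sigma_bool_eqpoll: "(SIGMA b:UNIV. F b) \<approx> F True <+> F False"
  unfolding eqpoll_def
  by (intro exI[of _ "\<lambda>(b, k). if b then Inl k else Inr k"]
        bij_betw_byWitness[where f' = "case_sum (Pair True) (Pair False)"]) auto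

lemma coproduct2_same: "coproduct2 P Q \<doteq> case_prod (case_bool P Q)"
proof (rule same_multiplicityI)
  fix x
  have "fibre (case_prod (case_bool P Q)) x \<approx> fibre P x <+> fibre Q x"
    using Sigma_bool_eqpoll[of "\<lambda>b. fibre (case_bool P Q b) x"] by (simp add: fibre_case_prod)
  then show "fibre (coproduct2 P Q) x \<approx> fibre (case_prod (case_bool P Q)) x"
    by (rule eqpoll_trans[OF fibre_coproduct2 eqpoll_sym])
qed

lemma fibre_countable_coproduct: "fibre (countable_coproduct P) x \<approx> (SIGMA n:UNIV. fibre (P n) x)"
  using same_multiplicityD[OF countable_coproduct_same] by (simp add: fibre_case_prod)

lemma Plus_commute_eqpoll: "A <+> B \<approx> B <+> A"
  unfolding eqpoll_def
  by (intro exI[of _ "case_sum Inr Inl"] bij_betw_byWitness[where f' = "case_sum Inr Inl"]) auto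

lemma Plus_assoc_eqpoll: "(A <+> B) <+> C \<approx> A <+> (B <+> C)"
  unfolding eqpoll_def
  by (intro exI[of _ "case_sum (case_sum Inl (Inr \<circ> Inl)) (Inr \<circ> Inr)"]
        bij_betw_byWitness[where f' = "case_sum (Inl \<circ> Inl) (case_sum (Inl \<circ> Inr) Inr)"]) auto

lemma Plus_empty_eqpoll: "{} <+> A \<approx> A"
  by (simp add: Plus_def)

lemma Sigma_Suc_eqpoll: "(SIGMA n:UNIV. F n) \<approx> F 0 <+> (SIGMA n:UNIV. F (Suc n))"
  unfolding eqpoll_def
  by (intro exI[of _ "\<lambda>(n, k). case n of 0 \<Rightarrow> Inl k | Suc m \<Rightarrow> Inr (m, k)"]
        bij_betw_byWitness[where f' = "case_sum (Pair 0) (\<lambda>(m, k). (Suc m, k))"])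
    (auto split: nat.splits)

lemma Sigma_Plus_eqpoll: "(SIGMA n:I. F n <+> G n) \<approx> (SIGMA n:I. F n) <+> (SIGMA n:I. G n)"
  unfolding eqpoll_def
  by (intro exI[of _ "\<lambda>(n, z). case z of Inl k \<Rightarrow> Inl (n, k) | Inr k \<Rightarrow> Inr (n, k)"]
        bij_betw_byWitness[where f' = "case_sum (\<lambda>(n, k). (n, Inl k)) (\<lambda>(n, k). (n, Inr k))"])
    auto

section \<open>Equidecomposability\<close>

context stationarily_measurable_space
begin

definition preimage :: "'s \<Rightarrow> 'x set \<Rightarrow> 'x set" where
  "preimage s A = {x \<in> space M. act s x \<in> A}"

lemma act_space: "s \<in> carrier S \<Longrightarrow> x \<in> space M \<Longrightarrow> act s x \<in> space M"
  using act_measurable measurable_space by metis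

lemma preimage_sets: "s \<in> carrier S \<Longrightarrow> A \<in> sets M \<Longrightarrow> preimage s A \<in> sets M"
  using measurable_sets[OF act_measurable] by (simp add: preimage_def vimage_def Int_def conj_commute)

lemma preimage_one: "A \<in> sets M \<Longrightarrow> preimage \<one> A = A"
  using sets.sets_into_space act_one by (fastforce simp: preimage_def)

lemma preimage_mult:
  "s \<in> carrier S \<Longrightarrow> t \<in> carrier S \<Longrightarrow> preimage (s \<otimes> t) A = preimage t (preimage s A)"
  by (auto simp: preimage_def act_mult act_space)

lemma preimage_empty [simp]: "preimage s {} = {}"
  by (simp add: preimage_def)

lemma coproduct_preimage_eq: "coproduct_preimage M act s P = (\<lambda>j. preimage s (P j))"
  by (simp add: coproduct_preimage_def preimage_def)

text \<open>
  The case of a single piece, read as \<open>[A] = [B]\<close>: a set has the type of each of its preimages, by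
  \<open>translates_preimage\<close>, and \<open>translates\<close> compares two sets through a common preimage.
\<close>

definition translates :: "'x set \<Rightarrow> 'x set \<Rightarrow> bool" where
  "translates A B \<longleftrightarrow> A \<in> sets M \<and> B \<in> sets M \<and>
     (\<exists>s\<in>carrier S. \<exists>t\<in>carrier S. preimage s A = preimage t B)"

lemma translates_refl: "A \<in> sets M \<Longrightarrow> translates A A"
  by (auto simp: translates_def)

lemma translates_sym: "translates A B \<Longrightarrow> translates B A"
  unfolding translates_def by metis

lemma translates_preimage: "s \<in> carrier S \<Longrightarrow> A \<in> sets M \<Longrightarrow> translates A (preimage s A)"
  unfolding translates_def using preimage_one preimage_sets by (metis one_closed)

text \<open>
  The relations \<open>s\<^sup>-\<^sup>1 A = t\<^sup>-\<^sup>1 B\<close> and \<open>u\<^sup>-\<^sup>1 B = v\<^sup>-\<^sup>1 C\<close> compose once \<open>t a = u b\<close> can be solved: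
  then \<open>(s a)\<^sup>-\<^sup>1 A = (t a)\<^sup>-\<^sup>1 B = (u b)\<^sup>-\<^sup>1 B = (v b)\<^sup>-\<^sup>1 C\<close>. Commuting idempotents provide
  \<open>a = t' u u'\<close> and \<open>b = u' t t'\<close>.
\<close>

lemma translates_trans:
  assumes "translates A B" "translates B C"
  shows "translates A C"
proof -
  obtain s t where st: "s \<in> carrier S" "t \<in> carrier S" "preimage s A = preimage t B"
    using assms(1) by (auto simp: translates_def)
  obtain u v where uv: "u \<in> carrier S" "v \<in> carrier S" "preimage u B = preimage v C"
    using assms(2) by (auto simp: translates_def)
  obtain t' where t': "t' \<in> carrier S" "t \<otimes> t' \<otimes> t = t" using weak_inverseE[OF st(2)] .
  obtain u' where u': "u' \<in> carrier S" "u \<otimes> u' \<otimes> u = u" using weak_inverseE[OF uv(1)] .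
  define a where "a = t' \<otimes> (u \<otimes> u')"
  define b where "b = u' \<otimes> (t \<otimes> t')"
  have ab: "a \<in> carrier S" "b \<in> carrier S" using st uv t' u' by (simp_all add: a_def b_def)
  have idem: "t \<otimes> t' \<otimes> (t \<otimes> t') = t \<otimes> t'" "u \<otimes> u' \<otimes> (u \<otimes> u') = u \<otimes> u'"
    using st uv t' u' by (simp_all add: m_assoc[symmetric])
  have "t \<otimes> a = (t \<otimes> t') \<otimes> (u \<otimes> u')"
    using st uv t' u' by (simp add: a_def m_assoc)
  also have "\<dots> = (u \<otimes> u') \<otimes> (t \<otimes> t')"
    using st uv t' u' idem by (intro idempotents_commute) auto
  also have "\<dots> = u \<otimes> b"
    using st uv t' u' by (simp add: b_def m_assoc)
  finally have eq: "t \<otimes> a = u \<otimes> b" .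
  have "preimage (s \<otimes> a) A = preimage (t \<otimes> a) B"
    using st ab by (simp add: preimage_mult)
  also have "\<dots> = preimage (v \<otimes> b) C"
    unfolding eq using uv ab by (simp add: preimage_mult)
  finally show ?thesis
    using assms st uv ab unfolding translates_def by blast
qed

text \<open>
  If \<open>s\<^sup>-\<^sup>1 A = t\<^sup>-\<^sup>1 B\<close>, this set is saturated for both idempotents \<open>e = s' s\<close> and \<open>f = t' t\<close>. Replacing
  \<open>s\<close> and \<open>t\<close> by \<open>p = s f\<close> and \<open>q = t e\<close> changes neither preimage and makes
  \<open>r = f s'\<close> act as an inverse of \<open>p\<close> on the sets \<open>q\<^sup>-\<^sup>1 (B k)\<close>. The part of \<open>A\<close> over \<open>B k\<close>
  is then \<open>A \<inter> r\<^sup>-\<^sup>1 (q\<^sup>-\<^sup>1 (B k))\<close>. Points of \<open>A\<close> outside all these parts can exist, as \<open>p\<close> need not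
  be onto; their preimage under \<open>p\<close> is empty, so they may be added to any one part.
\<close>

lemma translates_partition:
  fixes B :: "'k::countable \<Rightarrow> 'x set"
  assumes AB: "translates A (\<Union>k. B k)" and B: "\<And>k. B k \<in> sets M" and disj: "disjoint_family B"
  obtains A' where "disjoint_family A'" "A = (\<Union>k. A' k)" "\<And>k. translates (A' k) (B k)"
proof -
  let ?B = "\<Union>k. B k"
  obtain s t where st: "s \<in> carrier S" "t \<in> carrier S" "preimage s A = preimage t ?B"
    and A: "A \<in> sets M"
    using AB by (auto simp: translates_def)
  obtain s' where s': "s' \<in> carrier S" "s \<otimes> s' \<otimes> s = s" using weak_inverseE[OF st(1)] .
  obtain t' where t': "t' \<in> carrier S" "t \<otimes> t' \<otimes> t = t" using weak_inverseE[OF st(2)] .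
  define e where "e = s' \<otimes> s"
  define f where "f = t' \<otimes> t"
  have ef: "e \<in> carrier S" "f \<in> carrier S" using st s' t' by (simp_all add: e_def f_def)
  have se: "s \<otimes> e = s" and tf: "t \<otimes> f = t"
    using st s' t' by (simp_all add: e_def f_def m_assoc[symmetric])
  have ee: "e \<otimes> e = e"
    using st s' se unfolding e_def by (simp add: m_assoc)
  have ff: "f \<otimes> f = f"
    using st t' tf unfolding f_def by (simp add: m_assoc)
  have comm: "e \<otimes> f = f \<otimes> e" using idempotents_commute ef ee ff by blast
  define p where "p = s \<otimes> f"
  define q where "q = t \<otimes> e"
  define r where "r = f \<otimes> s'"
  have c: "p \<in> carrier S" "q \<in> carrier S" "r \<in> carrier S"
    using st s' ef by (simp_all add: p_def q_def r_def)
  have pA: "preimage p A = preimage t ?B"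
  proof -
    have "preimage p A = preimage f (preimage t ?B)"
      unfolding p_def using st ef by (simp add: preimage_mult)
    also have "\<dots> = preimage (t \<otimes> f) ?B" using st ef by (simp add: preimage_mult)
    finally show ?thesis by (simp add: tf)
  qed
  have qB: "preimage q ?B = preimage t ?B"
  proof -
    have "preimage q ?B = preimage e (preimage s A)"
      unfolding q_def using st ef by (simp add: preimage_mult)
    also have "\<dots> = preimage (s \<otimes> e) A" using st ef by (simp add: preimage_mult)
    finally show ?thesis by (simp add: se st)
  qed
  \<comment> \<open>\<open>x \<mapsto> r p x\<close> does not change whether \<open>q x\<close> lies in \<open>B k\<close>\<close>
  have qrp: "q \<otimes> r \<otimes> p = q"
  proof -
    have "q \<otimes> r \<otimes> p = t \<otimes> (e \<otimes> f) \<otimes> (e \<otimes> f)"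
      using st s' ef unfolding p_def q_def r_def e_def by (simp add: m_assoc)
    also have "\<dots> = t \<otimes> (e \<otimes> f)"
      using st ef ee ff idempotent_mult by (simp add: m_assoc)
    also have "\<dots> = q"
      unfolding comm q_def using st ef tf by (simp add: m_assoc[symmetric])
    finally show ?thesis .
  qed
  define C where "C k = A \<inter> preimage r (preimage q (B k))" for k
  have C: "C k \<in> sets M" for k
    using A B c by (auto simp: C_def intro: preimage_sets)
  have pC: "preimage p (C k) = preimage q (B k)" for k
  proof -
    have "preimage p (C k) = preimage p A \<inter> preimage p (preimage r (preimage q (B k)))"
      by (auto simp: C_def preimage_def)
    also have "preimage p (preimage r (preimage q (B k))) = preimage (q \<otimes> r \<otimes> p) (B k)"
      using c by (simp add: preimage_mult)
    also have "preimage p A \<inter> preimage (q \<otimes> r \<otimes> p) (B k) = preimage q (B k)"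
      unfolding pA qrp qB[symmetric] by (auto simp: preimage_def)
    finally show ?thesis .
  qed
  define N where "N = A - (\<Union>k. C k)"
  have N: "N \<in> sets M" using A C by (auto simp: N_def)
  have "preimage p N = preimage p A - (\<Union>k. preimage p (C k))"
    by (auto simp: N_def preimage_def)
  also have "\<dots> = {}"
    unfolding pC pA qB[symmetric] by (auto simp: preimage_def)
  finally have pN: "preimage p N = {}" .
  \<comment> \<open>\<^const>\<open>undefined\<close> is just some index\<close>
  define A' where "A' k = (if k = undefined then C k \<union> N else C k)" for k
  have CC: "k = l" if "x \<in> C k" "x \<in> C l" for x k l
    using that disj by (auto simp: C_def preimage_def disjoint_family_on_def)
  show thesis
  proof (rule that[of A'])
    show "disjoint_family A'"
      unfolding disjoint_family_on_def A'_def using CC by (auto simp: N_def)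
    have "C k \<subseteq> A' k" "N \<subseteq> A' undefined" "A' k \<subseteq> C k \<union> N" for k
      by (auto simp: A'_def)
    then have "(\<Union>k. A' k) = (\<Union>k. C k) \<union> N" by blast
    also have "\<dots> = A" by (auto simp: N_def C_def)
    finally show "A = (\<Union>k. A' k)" ..
    fix k
    have "preimage p (A' k) = preimage p (C k) \<union> (if k = undefined then preimage p N else {})"
      by (auto simp: A'_def preimage_def)
    then have "preimage p (A' k) = preimage q (B k)" by (simp add: pC pN)
    moreover have "A' k \<in> sets M" using C N by (simp add: A'_def)
    ultimately show "translates (A' k) (B k)"
      using B c by (auto simp: translates_def)
  qed
qed

text \<open>
  Equidecomposability in normal form, for arbitrary countable index types: the pieces are single sets and not
  coproducts. It agrees with \<^const>\<open>equidecomposable\<close> on sequences, see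
  \<open>equidecomposable_iff\<close>.
\<close>

definition equi :: "('i \<Rightarrow> 'x set) \<Rightarrow> ('j \<Rightarrow> 'x set) \<Rightarrow> bool" where
  "equi P Q \<longleftrightarrow> (\<forall>i. P i \<in> sets M) \<and> (\<forall>j. Q j \<in> sets M) \<and>
     (\<exists>A B :: nat \<Rightarrow> 'x set. (\<forall>n. translates (A n) (B n)) \<and> P \<doteq> A \<and> Q \<doteq> B)"

lemma equi_sets: "equi P Q \<Longrightarrow> P i \<in> sets M" "equi P Q \<Longrightarrow> Q j \<in> sets M"
  by (simp_all add: equi_def)

lemma translates_sets: "translates A B \<Longrightarrow> A \<in> sets M" "translates A B \<Longrightarrow> B \<in> sets M"
  by (simp_all add: translates_def)

lemma equiE:
  assumes "equi P Q"
  obtains A B :: "nat \<Rightarrow> 'x set" where "\<And>n. translates (A n) (B n)" "P \<doteq> A" "Q \<doteq> B"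
  using assms unfolding equi_def by blast

lemma equiI:
  fixes A B :: "'n::countable \<Rightarrow> 'x set"
  assumes "\<And>n. translates (A n) (B n)" "P \<doteq> A" "Q \<doteq> B"
    and "\<And>i. P i \<in> sets M" "\<And>j. Q j \<in> sets M"
  shows "equi P Q"
  unfolding equi_def
proof (intro conjI allI exI)
  show "translates (sequence_of A n) (sequence_of B n)" for n
    using assms(1) translates_refl by (simp add: sequence_of_def)
  show "P \<doteq> sequence_of A" "Q \<doteq> sequence_of B"
    using assms(2,3) sequence_of_same same_multiplicity_trans by blast+
qed (use assms in auto)

lemma equi_same:
  fixes Q :: "'j::countable \<Rightarrow> 'x set"
  assumes "P \<doteq> Q" "\<And>i. P i \<in> sets M" "\<And>j. Q j \<in> sets M"
  shows "equi P Q"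
  by (rule equiI[of Q Q]) (use assms translates_refl in auto)

lemma equi_sym: "equi P Q \<Longrightarrow> equi Q P"
  unfolding equi_def using translates_sym by blast

lemma equi_same_left:
  assumes "P' \<doteq> P" "equi P Q" "\<And>i. P' i \<in> sets M"
  shows "equi P' Q"
proof -
  obtain A B :: "nat \<Rightarrow> 'x set" where AB: "\<And>n. translates (A n) (B n)" "P \<doteq> A" "Q \<doteq> B"
    using assms(2) by (rule equiE) blast
  show ?thesis
    by (rule equiI[OF AB(1) same_multiplicity_trans[OF assms(1) AB(2)] AB(3) assms(3) equi_sets(2)[OF assms(2)]])
qed

lemma equi_same_right:
  assumes "equi P Q" "Q \<doteq> Q'" "\<And>i. Q' i \<in> sets M"
  shows "equi P Q'"
  using equi_same_left[OF same_multiplicity_sym[OF assms(2)] equi_sym[OF assms(1)] assms(3)]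
  by (rule equi_sym)

text \<open>
  Cutting along the given family \<open>Q\<close> turns the second set of pieces into a literal partition
  of \<open>Q\<close>; the first set is cut correspondingly, by \<open>translates_partition\<close>.
\<close>

lemma equi_normal_form:
  fixes Q :: "'j::countable \<Rightarrow> 'x set"
  assumes "equi P Q"
  obtains A B :: "nat \<Rightarrow> 'j \<Rightarrow> 'x set" where "\<And>n j. translates (A n j) (B n j)"
    "P \<doteq> case_prod A" "is_partition Q (\<lambda>j n. B n j)"
proof -
  obtain A B :: "nat \<Rightarrow> 'x set" where AB: "\<And>n. translates (A n) (B n)" "P \<doteq> A" "Q \<doteq> B"
    using assms by (rule equiE) blast
  obtain W where W: "\<And>n j. W n j \<in> sets M" "is_partition B W" "is_partition Q (\<lambda>j n. W n j)"
    using common_refinement[OF same_multiplicity_sym[OF AB(3)] translates_sets(2)[OF AB(1)] equi_sets(2)[OF assms]]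
    by blast
  have "\<exists>A'. disjoint_family A' \<and> A n = (\<Union>j. A' j) \<and> (\<forall>j. translates (A' j) (W n j))" for n
  proof -
    have "translates (A n) (\<Union>j. W n j)"
      using AB(1) is_partitionD(1)[OF W(2)] by metis
    moreover have "disjoint_family (W n)" using W(2) by (simp add: is_partition_def)
    ultimately show ?thesis using W(1) translates_partition by metis
  qed
  then obtain A' where A': "\<And>n. disjoint_family (A' n)" "\<And>n. A n = (\<Union>j. A' n j)"
    "\<And>n j. translates (A' n j) (W n j)" by metis
  have "is_partition A A'" using A' by (simp add: is_partition_def)
  then have "P \<doteq> case_prod A'"
    using AB(2) same_multiplicity_partition same_multiplicity_trans by blast
  then show thesis using that A'(3) W(3) by blast
qed

lemma equi_trans:
  fixes P :: "'i::countable \<Rightarrow> 'x set" and Q :: "'j::countable \<Rightarrow> 'x set" and R :: "'k::countable \<Rightarrow> 'x set"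
  assumes PQ: "equi P Q" and QR: "equi Q R"
  shows "equi P R"
proof -
  obtain A B :: "nat \<Rightarrow> 'j \<Rightarrow> 'x set" where AB: "\<And>n j. translates (A n j) (B n j)" "P \<doteq> case_prod A" "is_partition Q (\<lambda>j n. B n j)"
    using PQ by (rule equi_normal_form) blast
  have "Q \<doteq> case_prod B"
    by (rule same_multiplicity_trans[OF same_multiplicity_partition[OF AB(3)] same_multiplicity_swap])
  moreover have "case_prod B i \<in> sets M" for i
    using translates_sets(2)[OF AB(1)] by (cases i) simp
  ultimately have "equi R (case_prod B)"
    using equi_same_right[OF equi_sym[OF QR]] by blast
  then obtain C D :: "nat \<Rightarrow> nat \<times> 'j \<Rightarrow> 'x set" where CD: "\<And>n j. translates (C n j) (D n j)" "R \<doteq> case_prod C"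
    "is_partition (case_prod B) (\<lambda>j n. D n j)"
    by (rule equi_normal_form) blast
  have "\<exists>A'. disjoint_family A' \<and> case_prod A i = (\<Union>n. A' n) \<and> (\<forall>n. translates (A' n) (D n i))" for i
  proof -
    have "translates (case_prod A i) (case_prod B i)" using AB(1) by (cases i) simp
    then have "translates (case_prod A i) (\<Union>n. D n i)"
      using is_partitionD(1)[OF CD(3)] by metis
    moreover have "disjoint_family (\<lambda>n. D n i)" using CD(3) unfolding is_partition_def by blast
    ultimately show ?thesis using translates_sets(2)[OF CD(1)] translates_partition by metis
  qed
  then obtain A' :: "nat \<times> 'j \<Rightarrow> nat \<Rightarrow> 'x set" where A': "\<And>i. disjoint_family (A' i)" "\<And>i. case_prod A i = (\<Union>n. A' i n)"
    "\<And>i n. translates (A' i n) (D n i)" by metis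
  have "is_partition (case_prod A) A'" using A'(1,2) unfolding is_partition_def by blast
  then have "P \<doteq> case_prod A'"
    by (rule same_multiplicity_trans[OF AB(2) same_multiplicity_partition])
  moreover have "R \<doteq> case_prod (\<lambda>i n. C n i)"
    by (rule same_multiplicity_trans[OF CD(2) same_multiplicity_swap])
  moreover have "translates (case_prod A' i) (case_prod (\<lambda>i n. C n i) i)" for i
    using translates_trans[OF A'(3) translates_sym[OF CD(1)]] by (cases i) simp
  ultimately show ?thesis
    using equi_sets(1)[OF PQ] equi_sets(2)[OF QR] by (intro equiI[of "case_prod A'" "case_prod (\<lambda>i n. C n i)"])
qed

lemma equi_case_prod:
  fixes P Q :: "'i::countable \<Rightarrow> 'j::countable \<Rightarrow> 'x set"
  assumes "\<And>i. equi (P i) (Q i)"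
  shows "equi (case_prod P) (case_prod Q)"
proof -
  have "\<exists>A B :: nat \<Rightarrow> 'x set. (\<forall>n. translates (A n) (B n)) \<and> P i \<doteq> A \<and> Q i \<doteq> B" for i
    using assms unfolding equi_def by blast
  then obtain A B :: "'i \<Rightarrow> nat \<Rightarrow> 'x set" where AB: "\<And>i n. translates (A i n) (B i n)"
    "\<And>i. P i \<doteq> A i" "\<And>i. Q i \<doteq> B i" by metis
  show ?thesis
  proof (rule equiI[of "case_prod A" "case_prod B"])
    show "translates (case_prod A n) (case_prod B n)" for n using AB(1) by (cases n) simp
    show "case_prod P i \<in> sets M" "case_prod Q i \<in> sets M" for i
      using equi_sets[OF assms] by (cases i; simp)+
  qed (use AB same_multiplicity_case_prod in blast)+
qed

text \<open>
  A decomposition of one side into summands can be realised on the other side by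
  a literal partition of every member, and not only up to identification. Nested representatives
  for the remainder law are obtained in this way.
\<close>

lemma equi_split:
  fixes P :: "'p::countable \<Rightarrow> 'x set" and Q :: "'i::countable \<Rightarrow> 'j::countable \<Rightarrow> 'x set"
  assumes "equi P (case_prod Q)"
  obtains R where "is_partition P R" "\<And>i. equi (\<lambda>p. R p i) (Q i)"
proof -
  obtain A B :: "nat \<Rightarrow> 'i \<times> 'j \<Rightarrow> 'x set" where AB: "\<And>n k. translates (A n k) (B n k)"
    "P \<doteq> case_prod A" "is_partition (case_prod Q) (\<lambda>k n. B n k)"
    using assms by (rule equi_normal_form) blast
  have "case_prod A k \<in> sets M" for k
    using translates_sets(1)[OF AB(1)] by (cases k) simp
  with AB(2) equi_sets(1)[OF assms] obtain W where W: "\<And>p k. W p k \<in> sets M" "is_partition P W"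
    "is_partition (case_prod A) (\<lambda>k p. W p k)"
    using common_refinement[of P "case_prod A" M] by blast
  define R where "R p i = (\<Union>(n, j)\<in>UNIV. W p (n, i, j))" for p i
  show thesis
  proof (rule that[of R])
    show "is_partition P R"
      unfolding is_partition_def
    proof (intro allI conjI)
      fix p
      show "disjoint_family (R p)"
        using is_partitionD(2)[OF W(2)] by (auto simp: disjoint_family_on_def R_def)
      show "P p = (\<Union>i. R p i)"
        using is_partitionD(1)[OF W(2)] by (auto simp: R_def) 
    qed
    fix i
    have "is_partition (\<lambda>p. R p i) (\<lambda>p (n, j). W p (n, i, j))"
      unfolding is_partition_def disjoint_family_on_def
      using is_partitionD(2)[OF W(2)] by (auto simp: R_def)
    then have "(\<lambda>p. R p i) \<doteq> case_prod (\<lambda>p (n, j). W p (n, i, j))"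
      by (rule same_multiplicity_partition)
    also have "\<dots> \<doteq> case_prod (\<lambda>(n, j) p. W p (n, i, j))"
      using same_multiplicity_swap[of "\<lambda>p (n, j). W p (n, i, j)"] by (simp add: case_prod_unfold)
    also have "is_partition (\<lambda>(n, j). A n (i, j)) (\<lambda>(n, j) p. W p (n, i, j))"
      using W(3) by (simp add: is_partition_def case_prod_unfold)
    then have "case_prod (\<lambda>(n, j) p. W p (n, i, j)) \<doteq> (\<lambda>(n, j). A n (i, j))"
      using same_multiplicity_sym same_multiplicity_partition by blast
    finally have RA: "(\<lambda>p. R p i) \<doteq> (\<lambda>(n, j). A n (i, j))" .
    have "is_partition (Q i) (\<lambda>j n. B n (i, j))"
      using AB(3) by (simp add: is_partition_def)
    then have QB: "Q i \<doteq> (\<lambda>(n, j). B n (i, j))"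
      using same_multiplicity_partition same_multiplicity_swap same_multiplicity_trans by blast
    show "equi (\<lambda>p. R p i) (Q i)"
    proof (rule equiI[OF _ RA QB])
      show "translates (case k of (n, j) \<Rightarrow> A n (i, j)) (case k of (n, j) \<Rightarrow> B n (i, j))" for k
        using AB(1) by (cases k) simp
      show "R p i \<in> sets M" for p
        unfolding R_def using W(1) by (auto intro!: sets.countable_UN'')
      show "Q i j \<in> sets M" for j
        using equi_sets(2)[OF assms, of "(i, j)"] by simp
    qed
  qed
qed

end

section \<open>The type monoid\<close>

context stationarily_measurable_space
begin

lemma coproducts_iff: "P \<in> coproducts M \<longleftrightarrow> (\<forall>j. P j \<in> sets M)"
  by (simp add: coproducts_def)

lemma equi_coproducts:
  assumes "equi P Q"
  shows "P \<in> coproducts M" "Q \<in> coproducts M"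
  using equi_sets[OF assms] by (simp_all add: coproducts_iff)

text \<open>
  Coproducts as pieces give nothing new: a coproduct \<open>P' i\<close> is related member by member to its
  preimage under \<open>s i\<close>. Conversely a single set is a coproduct with at most one nonempty
  member.
\<close>

lemma equidecomposable_iff: "(P, Q) \<in> equidecomposable M S act \<longleftrightarrow> equi P Q"
proof
  assume "(P, Q) \<in> equidecomposable M S act"
  then obtain P' Q' s t where PQ: "P \<in> coproducts M" "Q \<in> coproducts M"
    and closed: "\<And>j. P' j \<in> coproducts M" "\<And>j. Q' j \<in> coproducts M"
      "\<And>j. s j \<in> carrier S" "\<And>j. t j \<in> carrier S"
    and P: "same_coproduct M P (countable_coproduct P')"
    and Q: "same_coproduct M Q (countable_coproduct Q')"
    and st: "\<And>j. same_coproduct M (coproduct_preimage M act (s j) (P' j))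
                                 (coproduct_preimage M act (t j) (Q' j))"
    unfolding equidecomposable_def by blast
  have sets: "P' i j \<in> sets M" "Q' i j \<in> sets M" for i j
    using closed by (auto simp: coproducts_iff)
  have "equi (P' i) (Q' i)" for i
  proof -
    have pre: "(\<lambda>j. preimage (s i) (P' i j)) \<in> coproducts M" "(\<lambda>j. preimage (t i) (Q' i j)) \<in> coproducts M"
      using closed sets preimage_sets by (simp_all add: coproducts_iff)
    have "equi (P' i) (\<lambda>j. preimage (s i) (P' i j))"
      by (rule equiI[of "P' i" "\<lambda>j. preimage (s i) (P' i j)"])
        (use closed sets preimage_sets translates_preimage in auto)
    moreover have "equi (\<lambda>j. preimage (s i) (P' i j)) (\<lambda>j. preimage (t i) (Q' i j))"
      using st[of i] pre unfolding coproduct_preimage_eq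
      by (intro equi_same) (simp_all add: same_coproduct_iff coproducts_iff)
    moreover have "equi (\<lambda>j. preimage (t i) (Q' i j)) (Q' i)"
      by (rule equiI[of "\<lambda>j. preimage (t i) (Q' i j)" "Q' i"])
        (use closed sets preimage_sets translates_preimage translates_sym in auto)
    ultimately show ?thesis using equi_trans by blast
  qed
  then have *: "equi (case_prod P') (case_prod Q')" by (rule equi_case_prod)
  have "P \<doteq> case_prod P'" "Q \<doteq> case_prod Q'"
    using P Q PQ closed countable_coproduct_same same_multiplicity_trans
    by (metis countable_coproduct_closed same_coproduct_iff)+
  then show "equi P Q"
    using * PQ by (meson coproducts_iff equi_same_left equi_same_right same_multiplicity_sym)
next
  assume PQ: "equi P Q"
  then obtain A B :: "nat \<Rightarrow> 'x set" where AB: "\<And>n. translates (A n) (B n)" "P \<doteq> A" "Q \<doteq> B"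
    by (rule equiE) blast
  have "\<forall>n. \<exists>s t. s \<in> carrier S \<and> t \<in> carrier S \<and> preimage s (A n) = preimage t (B n)"
    using AB(1) unfolding translates_def by blast
  then obtain s t where st: "\<And>n. s n \<in> carrier S" "\<And>n. t n \<in> carrier S"
    "\<And>n. preimage (s n) (A n) = preimage (t n) (B n)"
    by metis
  \<comment> \<open>equality up to \<open>\<doteq>\<close> ignores the empty members\<close>
  define single :: "'x set \<Rightarrow> 'x coproduct" where "single C = (\<lambda>k. if k = 0 then C else {})" for C
  have single: "single C \<in> coproducts M" if "C \<in> sets M" for C
    using that by (simp add: single_def coproducts_iff)
  have same: "D \<doteq> countable_coproduct (\<lambda>n. single (D n))" for D :: "nat \<Rightarrow> 'x set"
  proof -
    have "D \<doteq> case_prod (\<lambda>n. single (D n))"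
      by (rule same_multiplicity_bij[where f = "\<lambda>n. (n, 0)"])
        (auto simp: bij_betw_def inj_on_def fibre_def single_def image_iff split: if_splits)
    then show ?thesis
      using countable_coproduct_same same_multiplicity_sym same_multiplicity_trans by blast
  qed
  have sets: "A n \<in> sets M" "B n \<in> sets M" for n using translates_sets[OF AB(1)] .
  have pre: "coproduct_preimage M act (s j) (single (A j)) = coproduct_preimage M act (t j) (single (B j))" for j
    unfolding coproduct_preimage_eq by (rule ext) (simp add: single_def st(3))
  have pre': "coproduct_preimage M act (t j) (single (B j)) \<in> coproducts M" for j
    unfolding coproduct_preimage_eq using st(2) sets(2) by (auto simp: single_def coproducts_iff preimage_sets)
  show "(P, Q) \<in> equidecomposable M S act"
    unfolding equidecomposable_def mem_Collect_eq prod.case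
  proof (intro conjI exI allI)
    show "same_coproduct M P (countable_coproduct (\<lambda>n. single (A n)))"
      using same_multiplicity_trans[OF AB(2) same] equi_coproducts[OF PQ] sets
      by (simp add: same_coproduct_iff countable_coproduct_closed single)
    show "same_coproduct M Q (countable_coproduct (\<lambda>n. single (B n)))"
      using same_multiplicity_trans[OF AB(3) same] equi_coproducts[OF PQ] sets
      by (simp add: same_coproduct_iff countable_coproduct_closed single)
    show "same_coproduct M (coproduct_preimage M act (s j) (single (A j)))
             (coproduct_preimage M act (t j) (single (B j)))" for j
      unfolding pre using pre'[of j] by (simp add: same_coproduct_iff)
  qed (use single sets st equi_coproducts[OF PQ] in auto)
qed

abbreviation T where "T \<equiv> type_monoid M S act"

definition type_of :: "'x coproduct \<Rightarrow> 'x coproduct_type" where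
  "type_of P = equidecomposable M S act `` {P}"

lemma equiv_equidecomposable: "equiv (coproducts M) (equidecomposable M S act)"
proof (rule equivI)
  show "equidecomposable M S act \<subseteq> coproducts M \<times> coproducts M"
    by (auto simp: equidecomposable_def)
  show "refl_on (coproducts M) (equidecomposable M S act)"
    by (rule refl_onI) (simp add: equidecomposable_iff equi_same coproducts_iff)
  show "sym (equidecomposable M S act)"
    by (rule symI) (simp add: equidecomposable_iff equi_sym)
  show "trans (equidecomposable M S act)"
    by (rule transI) (use equi_trans in \<open>simp add: equidecomposable_iff, blast\<close>)
qed

lemma type_of_eq_iff:
  "P \<in> coproducts M \<Longrightarrow> Q \<in> coproducts M \<Longrightarrow> type_of P = type_of Q \<longleftrightarrow> equi P Q"
  unfolding type_of_def using eq_equiv_class_iff[OF equiv_equidecomposable] equidecomposable_iff by blast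

lemma type_of_eqI: "equi P Q \<Longrightarrow> type_of P = type_of Q"
  by (simp add: type_of_eq_iff equi_coproducts)

lemma type_of_same:
  "P \<doteq> Q \<Longrightarrow> P \<in> coproducts M \<Longrightarrow> Q \<in> coproducts M \<Longrightarrow> type_of P = type_of Q"
  by (intro type_of_eqI equi_same) (simp_all add: coproducts_iff)

lemma type_of_carrier: "P \<in> coproducts M \<Longrightarrow> type_of P \<in> carrier T"
  by (simp add: type_monoid_def type_of_def quotientI)

lemma type_carrierE:
  assumes "a \<in> carrier T"
  obtains P where "P \<in> coproducts M" "a = type_of P"
  using assms by (auto simp: type_monoid_def type_of_def elim: quotientE)

lemma equi_coproduct2:
  assumes "equi P P'" "equi Q Q'"
  shows "equi (coproduct2 P Q) (coproduct2 P' Q')"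
proof -
  have "equi (case_prod (case_bool P Q)) (case_prod (case_bool P' Q'))"
    by (rule equi_case_prod) (use assms in \<open>auto split: bool.split\<close>)
  moreover have "coproduct2 P Q \<in> coproducts M" "coproduct2 P' Q' \<in> coproducts M"
    using assms by (simp_all add: coproduct2_closed equi_coproducts)
  ultimately show ?thesis
    using coproduct2_same same_multiplicity_sym
    by (meson coproducts_iff equi_same_left equi_same_right)
qed

lemma equi_countable_coproduct:
  assumes "\<And>n. equi (P n) (Q n)"
  shows "equi (countable_coproduct P) (countable_coproduct Q)"
proof -
  have "equi (case_prod P) (case_prod Q)"
    by (rule equi_case_prod) (rule assms)
  moreover have "countable_coproduct P \<in> coproducts M" "countable_coproduct Q \<in> coproducts M"
    using equi_coproducts[OF assms] by (simp_all add: countable_coproduct_closed)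
  ultimately show ?thesis
    using countable_coproduct_same same_multiplicity_sym
    by (meson coproducts_iff equi_same_left equi_same_right)
qed

lemma type_of_mult:
  assumes "P \<in> coproducts M" "Q \<in> coproducts M"
  shows "type_of P \<otimes>\<^bsub>T\<^esub> type_of Q = type_of (coproduct2 P Q)"
proof -
  have "congruent2 (equidecomposable M S act) (equidecomposable M S act)
      (\<lambda>P Q. equidecomposable M S act `` {coproduct2 P Q})"
  proof (rule congruent2I')
    fix P P' Q Q' assume "(P, P') \<in> equidecomposable M S act" "(Q, Q') \<in> equidecomposable M S act"
    then show "equidecomposable M S act `` {coproduct2 P Q} = equidecomposable M S act `` {coproduct2 P' Q'}"
      using type_of_eqI[OF equi_coproduct2] by (simp add: equidecomposable_iff type_of_def)
  qed
  then show ?thesis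
    using UN_equiv_class2[OF equiv_equidecomposable equiv_equidecomposable] assms
    by (simp add: type_monoid_def type_of_def)
qed

lemma type_one: "\<one>\<^bsub>T\<^esub> = type_of empty_coproduct"
  by (simp add: type_monoid_def type_of_def)

lemma comm_monoid_type_monoid: "comm_monoid T"
proof (rule comm_monoidI)
  show "\<one>\<^bsub>T\<^esub> \<in> carrier T" by (simp add: type_one type_of_carrier empty_coproduct_closed)
next
  fix a b assume "a \<in> carrier T" "b \<in> carrier T"
  then obtain P Q where PQ: "P \<in> coproducts M" "Q \<in> coproducts M" "a = type_of P" "b = type_of Q"
    by (metis type_carrierE)
  then show "a \<otimes>\<^bsub>T\<^esub> b \<in> carrier T" by (simp add: type_of_mult type_of_carrier coproduct2_closed)
  have "coproduct2 P Q \<doteq> coproduct2 Q P"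
    by (rule same_multiplicityI)
      (meson Plus_commute_eqpoll eqpoll_sym eqpoll_trans fibre_coproduct2)
  then show "a \<otimes>\<^bsub>T\<^esub> b = b \<otimes>\<^bsub>T\<^esub> a"
    using PQ by (simp add: type_of_mult type_of_same coproduct2_closed)
next
  fix a b c assume "a \<in> carrier T" "b \<in> carrier T" "c \<in> carrier T"
  then obtain P Q R where PQR: "P \<in> coproducts M" "Q \<in> coproducts M" "R \<in> coproducts M"
    "a = type_of P" "b = type_of Q" "c = type_of R"
    by (metis type_carrierE)
  have "coproduct2 (coproduct2 P Q) R \<doteq> coproduct2 P (coproduct2 Q R)"
  proof (rule same_multiplicityI)
    fix x
    have "fibre (coproduct2 (coproduct2 P Q) R) x \<approx> fibre (coproduct2 P Q) x <+> fibre R x"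
      by (rule fibre_coproduct2)
    also have "\<dots> \<approx> (fibre P x <+> fibre Q x) <+> fibre R x"
      by (intro sum_eqpoll_cong fibre_coproduct2 eqpoll_refl)
    also have "\<dots> \<approx> fibre P x <+> (fibre Q x <+> fibre R x)"
      by (rule Plus_assoc_eqpoll)
    also have "\<dots> \<approx> fibre P x <+> fibre (coproduct2 Q R) x"
      by (intro sum_eqpoll_cong eqpoll_sym[OF fibre_coproduct2] eqpoll_refl)
    also have "\<dots> \<approx> fibre (coproduct2 P (coproduct2 Q R)) x"
      by (rule eqpoll_sym[OF fibre_coproduct2])
    finally show "fibre (coproduct2 (coproduct2 P Q) R) x \<approx> fibre (coproduct2 P (coproduct2 Q R)) x" .
  qed
  then show "a \<otimes>\<^bsub>T\<^esub> b \<otimes>\<^bsub>T\<^esub> c = a \<otimes>\<^bsub>T\<^esub> (b \<otimes>\<^bsub>T\<^esub> c)"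
    using PQR by (simp add: type_of_mult type_of_same coproduct2_closed)
next
  fix a assume "a \<in> carrier T"
  then obtain P where P: "P \<in> coproducts M" "a = type_of P" by (rule type_carrierE)
  have "coproduct2 empty_coproduct P \<doteq> P"
  proof (rule same_multiplicityI)
    fix x
    have "fibre (coproduct2 empty_coproduct P) x \<approx> fibre empty_coproduct x <+> fibre P x"
      by (rule fibre_coproduct2)
    also have "fibre empty_coproduct x = {}"
      by (simp add: fibre_def empty_coproduct_def)
    also have "{} <+> fibre P x \<approx> fibre P x" by (rule Plus_empty_eqpoll)
    finally show "fibre (coproduct2 empty_coproduct P) x \<approx> fibre P x" .
  qed
  then show "\<one>\<^bsub>T\<^esub> \<otimes>\<^bsub>T\<^esub> a = a"
    using P by (simp add: type_one type_of_mult type_of_same coproduct2_closed empty_coproduct_closed)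
qed

lemma equi_coproduct2_split:
  fixes P Q1 Q2 :: "'x coproduct"
  assumes "equi P (coproduct2 Q1 Q2)"
  obtains P1 P2 where "equi P1 Q1" "equi P2 Q2" "\<And>k. P k = P1 k \<union> P2 k" "\<And>k. P1 k \<inter> P2 k = {}"
proof -
  have Q: "coproduct2 Q1 Q2 j \<in> sets M" for j using equi_sets(2)[OF assms] .
  have "Q1 j \<in> sets M" "Q2 j \<in> sets M" for j
    using Q[of "sum_encode (Inl j)"] Q[of "sum_encode (Inr j)"] by (simp_all add: coproduct2_def)
  then have "case_prod (case_bool Q1 Q2) i \<in> sets M" for i
    by (cases i) (simp split: bool.split)
  then have "equi P (case_prod (case_bool Q1 Q2))"
    using equi_same_right[OF assms coproduct2_same] by blast
  then obtain R :: "nat \<Rightarrow> bool \<Rightarrow> 'x set" where R: "is_partition P R" "\<And>i. equi (\<lambda>p. R p i) (case_bool Q1 Q2 i)"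
    by (rule equi_split) blast
  show thesis
  proof (rule that[of "\<lambda>p. R p True" "\<lambda>p. R p False"])
    show "equi (\<lambda>p. R p True) Q1" "equi (\<lambda>p. R p False) Q2"
      using R(2)[of True] R(2)[of False] by simp_all
    show "P k = R k True \<union> R k False" for k
      using is_partitionD(1)[OF R(1)] by (simp add: UNIV_bool Un_commute)
    show "R k True \<inter> R k False = {}" for k
      using is_partitionD(2)[OF R(1), of _ k True False] by blast
  qed
qed

lemma same_multiplicity_Un:
  assumes "\<And>k. P k = P1 k \<union> P2 k" "\<And>k. P1 k \<inter> P2 k = {}"
  shows "P \<doteq> coproduct2 P1 P2"
proof (rule same_multiplicityI)
  fix x
  have "\<not> (x \<in> P1 k \<and> x \<in> P2 k)" for k using assms(2)[of k] by blast
  then have "inj_on (case_sum id id) (fibre P1 x <+> fibre P2 x)"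
    by (auto simp: inj_on_def fibre_def)
  moreover have "case_sum id id ` (fibre P1 x <+> fibre P2 x) = fibre P x"
    by (auto simp: Plus_def image_Un image_image fibre_def assms(1))
  ultimately have "fibre P1 x <+> fibre P2 x \<approx> fibre P x"
    unfolding eqpoll_def bij_betw_def by blast
  then show "fibre P x \<approx> fibre (coproduct2 P1 P2) x"
    by (meson eqpoll_sym eqpoll_trans fibre_coproduct2)
qed

text \<open>
  Given \<open>[A] + [B] = [C] + [D]\<close>, each member of \<open>A \<coprod> B\<close> splits into a part for \<open>C\<close> and a part for
  \<open>D\<close>. The four summands are the two parts restricted to the members of \<open>A\<close> and to those of \<open>B\<close>.
\<close>

lemma refinement_monoid_type_monoid: "refinement_monoid T"
proof (intro refinement_monoid.intro refinement_monoid_axioms.intro)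
  show "comm_monoid T" by (rule comm_monoid_type_monoid)
  fix a b c d
  assume "a \<in> carrier T" "b \<in> carrier T" "c \<in> carrier T" "d \<in> carrier T" and eq: "a \<otimes>\<^bsub>T\<^esub> b = c \<otimes>\<^bsub>T\<^esub> d"
  then obtain A B C D where A: "A \<in> coproducts M" "a = type_of A" and B: "B \<in> coproducts M" "b = type_of B"
    and C: "C \<in> coproducts M" "c = type_of C" and D: "D \<in> coproducts M" "d = type_of D"
    by (metis type_carrierE)
  have "equi (coproduct2 A B) (coproduct2 C D)"
    using eq A B C D by (simp add: type_of_mult type_of_eq_iff coproduct2_closed)
  then obtain C' D' where CD: "equi C' C" "equi D' D" "\<And>k. coproduct2 A B k = C' k \<union> D' k"
    "\<And>k. C' k \<inter> D' k = {}"
    by (rule equi_coproduct2_split) blast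
  \<comment> \<open>the positions of the members of \<open>A\<close> and of \<open>B\<close> in their coproduct\<close>
  define L R :: "nat \<Rightarrow> nat" where "L j = sum_encode (Inl j)" and "R j = sum_encode (Inr j)" for j
  have LR: "coproduct2 A B \<circ> L = A" "coproduct2 A B \<circ> R = B"
    by (auto simp: L_def R_def coproduct2_def)
  have closed: "P \<circ> L \<in> coproducts M" "P \<circ> R \<in> coproducts M" if "P \<in> coproducts M" for P
    using that by (simp_all add: coproducts_iff)
  have rejoin: "P \<doteq> coproduct2 (P \<circ> L) (P \<circ> R)" for P :: "'x coproduct"
  proof -
    have "coproduct2 (P \<circ> L) (P \<circ> R) = P"
    proof
      show "coproduct2 (P \<circ> L) (P \<circ> R) n = P n" for n
        using sum_decode_inverse[of n]
        by (cases "sum_decode n") (simp_all add: coproduct2_def L_def R_def)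
    qed
    then show ?thesis by simp
  qed
  note c = equi_coproducts(1)[OF CD(1)] equi_coproducts(1)[OF CD(2)]
  have "A k = (C' \<circ> L) k \<union> (D' \<circ> L) k" "B k = (C' \<circ> R) k \<union> (D' \<circ> R) k" for k
    using CD(3)[of "L k"] CD(3)[of "R k"] fun_cong[OF LR(1), of k] fun_cong[OF LR(2), of k] by simp_all
  then have "A \<doteq> coproduct2 (C' \<circ> L) (D' \<circ> L)" "B \<doteq> coproduct2 (C' \<circ> R) (D' \<circ> R)"
    by (intro same_multiplicity_Un; simp add: CD(4))+
  then have "a = type_of (C' \<circ> L) \<otimes>\<^bsub>T\<^esub> type_of (D' \<circ> L)" "b = type_of (C' \<circ> R) \<otimes>\<^bsub>T\<^esub> type_of (D' \<circ> R)"
    using A B closed[OF c(1)] closed[OF c(2)] by (simp_all add: type_of_mult type_of_same coproduct2_closed)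
  moreover have "c = type_of (C' \<circ> L) \<otimes>\<^bsub>T\<^esub> type_of (C' \<circ> R)"
    using type_of_eqI[OF CD(1)] type_of_same[OF rejoin] C closed[OF c(1)] c(1)
    by (simp add: type_of_mult coproduct2_closed)
  moreover have "d = type_of (D' \<circ> L) \<otimes>\<^bsub>T\<^esub> type_of (D' \<circ> R)"
    using type_of_eqI[OF CD(2)] type_of_same[OF rejoin] D closed[OF c(2)] c(2)
    by (simp add: type_of_mult coproduct2_closed)
  ultimately show "\<exists>w\<in>carrier T. \<exists>x\<in>carrier T. \<exists>y\<in>carrier T. \<exists>z\<in>carrier T.
      a = w \<otimes>\<^bsub>T\<^esub> x \<and> b = y \<otimes>\<^bsub>T\<^esub> z \<and> c = w \<otimes>\<^bsub>T\<^esub> y \<and> d = x \<otimes>\<^bsub>T\<^esub> z"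
    using type_of_carrier closed[OF c(1)] closed[OF c(2)] by blast
qed

text \<open>
  Computed from arbitrary representatives; \<open>type_sum_type_of\<close> shows that the choice does not matter.
\<close>

definition type_sum :: "(nat \<Rightarrow> 'x coproduct_type) \<Rightarrow> 'x coproduct_type" where
  "type_sum a = type_of (countable_coproduct (\<lambda>n. SOME P. P \<in> coproducts M \<and> a n = type_of P))"

lemma type_sum_type_of:
  assumes "\<And>n. P n \<in> coproducts M"
  shows "type_sum (\<lambda>n. type_of (P n)) = type_of (countable_coproduct P)"
proof -
  define R where "R = (\<lambda>n. SOME Q. Q \<in> coproducts M \<and> type_of (P n) = type_of Q)"
  have R: "R n \<in> coproducts M \<and> type_of (P n) = type_of (R n)" for n
    unfolding R_def by (rule someI[of _ "P n"]) (simp add: assms)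
  then have "equi (R n) (P n)" for n
    using assms type_of_eq_iff by metis
  then have "type_of (countable_coproduct R) = type_of (countable_coproduct P)"
    by (intro type_of_eqI equi_countable_coproduct)
  then show ?thesis unfolding type_sum_def R_def .
qed

lemma type_sequenceE:
  assumes "\<And>n. a n \<in> carrier T"
  obtains P where "\<And>n. P n \<in> coproducts M" "a = (\<lambda>n. type_of (P n))"
proof -
  have "\<forall>n. \<exists>P. P \<in> coproducts M \<and> a n = type_of P"
    using type_carrierE[OF assms] by blast
  from choice[OF this] obtain P where "\<forall>n. P n \<in> coproducts M \<and> a n = type_of (P n)" ..
  then show thesis by (intro that[of P] ext) simp_all
qed

text \<open>
  For the remainder law, splitting representatives again and again yields coproducts \<open>D n\<close> of type
  \<open>a n\<close> with \<open>D n k\<close> the disjoint union of \<open>D (n + 1) k\<close> and a set \<open>E n k\<close>, where \<open>E n\<close> has type \<open>b n\<close>. The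
  common remainder is represented by the intersections of the sets \<open>D n k\<close> over \<open>n\<close>.
\<close>

lemma countable_sum_monoid_type_monoid: "countable_sum_monoid T type_sum"
proof (intro countable_sum_monoid.intro countable_sum_monoid_axioms.intro)
  show "refinement_monoid T" by (rule refinement_monoid_type_monoid)
next
  fix f :: "nat \<Rightarrow> 'x coproduct_type" assume f: "\<And>n. f n \<in> carrier T"
  obtain P where P: "\<And>n. P n \<in> coproducts M" "f = (\<lambda>n. type_of (P n))"
    by (rule type_sequenceE[of f, OF f]) blast
  then show "type_sum f \<in> carrier T"
    by (simp add: type_sum_type_of type_of_carrier countable_coproduct_closed)
  have "countable_coproduct P \<doteq> coproduct2 (P 0) (countable_coproduct (\<lambda>n. P (Suc n)))"
  proof (rule same_multiplicityI)
    fix x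
    have "fibre (countable_coproduct P) x \<approx> (SIGMA n:UNIV. fibre (P n) x)"
      by (rule fibre_countable_coproduct)
    also have "\<dots> \<approx> fibre (P 0) x <+> (SIGMA n:UNIV. fibre (P (Suc n)) x)"
      by (rule Sigma_Suc_eqpoll)
    also have "\<dots> \<approx> fibre (P 0) x <+> fibre (countable_coproduct (\<lambda>n. P (Suc n))) x"
      by (intro sum_eqpoll_cong eqpoll_refl eqpoll_sym[OF fibre_countable_coproduct])
    also have "\<dots> \<approx> fibre (coproduct2 (P 0) (countable_coproduct (\<lambda>n. P (Suc n)))) x"
      by (rule eqpoll_sym[OF fibre_coproduct2])
    finally show "fibre (countable_coproduct P) x \<approx> \<dots>" .
  qed
  then show "type_sum f = f 0 \<otimes>\<^bsub>T\<^esub> type_sum (\<lambda>n. f (Suc n))"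
    using P by (simp add: type_sum_type_of type_of_mult type_of_same coproduct2_closed countable_coproduct_closed)
next
  fix f g :: "nat \<Rightarrow> 'x coproduct_type" assume f: "\<And>n. f n \<in> carrier T" and g: "\<And>n. g n \<in> carrier T"
  obtain P where P: "\<And>n. P n \<in> coproducts M" "f = (\<lambda>n. type_of (P n))"
    by (rule type_sequenceE[of f, OF f]) blast
  obtain Q where Q: "\<And>n. Q n \<in> coproducts M" "g = (\<lambda>n. type_of (Q n))"
    by (rule type_sequenceE[of g, OF g]) blast
  have "countable_coproduct (\<lambda>n. coproduct2 (P n) (Q n)) \<doteq>
      coproduct2 (countable_coproduct P) (countable_coproduct Q)"
  proof (rule same_multiplicityI)
    fix x
    have "fibre (countable_coproduct (\<lambda>n. coproduct2 (P n) (Q n))) x \<approx>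
        (SIGMA n:UNIV. fibre (coproduct2 (P n) (Q n)) x)"
      by (rule fibre_countable_coproduct)
    also have "\<dots> \<approx> (SIGMA n:UNIV. fibre (P n) x <+> fibre (Q n) x)"
      by (rule Sigma_eqpoll_cong[of id UNIV UNIV, simplified]) (rule fibre_coproduct2)
    also have "\<dots> \<approx> (SIGMA n:UNIV. fibre (P n) x) <+> (SIGMA n:UNIV. fibre (Q n) x)"
      by (rule Sigma_Plus_eqpoll)
    also have "\<dots> \<approx> fibre (countable_coproduct P) x <+> fibre (countable_coproduct Q) x"
      by (intro sum_eqpoll_cong eqpoll_sym[OF fibre_countable_coproduct])
    also have "\<dots> \<approx> fibre (coproduct2 (countable_coproduct P) (countable_coproduct Q)) x"
      by (rule eqpoll_sym[OF fibre_coproduct2])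
    finally show "fibre (countable_coproduct (\<lambda>n. coproduct2 (P n) (Q n))) x \<approx> \<dots>" .
  qed
  then show "type_sum (\<lambda>n. f n \<otimes>\<^bsub>T\<^esub> g n) = type_sum f \<otimes>\<^bsub>T\<^esub> type_sum g"
    using P Q by (simp add: type_sum_type_of type_of_mult type_of_same coproduct2_closed countable_coproduct_closed)
next
  fix a b :: "nat \<Rightarrow> 'x coproduct_type"
  assume a: "\<And>n. a n \<in> carrier T" and b: "\<And>n. b n \<in> carrier T" and ab: "\<And>n. a n = b n \<otimes>\<^bsub>T\<^esub> a (Suc n)"
  obtain A where A: "\<And>n. A n \<in> coproducts M" "a = (\<lambda>n. type_of (A n))"
    by (rule type_sequenceE[of a, OF a]) blast
  obtain B where B: "\<And>n. B n \<in> coproducts M" "b = (\<lambda>n. type_of (B n))"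
    by (rule type_sequenceE[of b, OF b]) blast
  have step: "equi (A n) (coproduct2 (B n) (A (Suc n)))" for n
    using ab[of n] A B by (simp add: type_of_mult type_of_eq_iff coproduct2_closed)
  define Q where "Q n D D' \<longleftrightarrow> (\<exists>E. equi E (B n) \<and> (\<forall>k. D k = E k \<union> D' k) \<and> (\<forall>k. E k \<inter> D' k = {}))"
    for n and D D' :: "'x coproduct"
  have "\<exists>D'. equi D' (A (Suc n)) \<and> Q n D D'" if "equi D (A n)" for n D
  proof -
    have "equi D (coproduct2 (B n) (A (Suc n)))" using that step equi_trans by blast
    then obtain E D' where "equi E (B n)" "equi D' (A (Suc n))" "\<And>k. D k = E k \<union> D' k" "\<And>k. E k \<inter> D' k = {}"
      by (rule equi_coproduct2_split) blast
    then show ?thesis unfolding Q_def by blast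
  qed
  moreover have "equi (A 0) (A 0)" using A by (intro equi_same) (simp_all add: coproducts_iff)
  ultimately obtain D where D: "\<And>n. equi (D n) (A n)" "\<And>n. Q n (D n) (D (Suc n))"
    using dependent_nat_choice[of "\<lambda>n D. equi D (A n)" Q] by blast
  then obtain E where E: "\<And>n. equi (E n) (B n)" "\<And>n k. D n k = E n k \<union> D (Suc n) k"
    "\<And>n k. E n k \<inter> D (Suc n) k = {}"
    unfolding Q_def by metis
  define C where "C k = (\<Inter>n. D n k)" for k
  have C: "C \<in> coproducts M"
    using equi_sets(1)[OF D(1)] by (auto simp: coproducts_iff C_def)
  have DE: "D n \<in> coproducts M" "E n \<in> coproducts M" for n
    using equi_coproducts D(1) E(1) by blast+
  have D_Suc: "D (Suc n) k \<subseteq> D n k" and E_sub: "E n k \<subseteq> D n k" for n k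
    using E(2)[of n k] by blast+
  have antimono: "D (n + i) k \<subseteq> D n k" for n i k
  proof (induction i)
    case (Suc i)
    then show ?case using D_Suc[of "n + i" k] by simp
  qed simp
  have "D n \<doteq> coproduct2 C (countable_coproduct (\<lambda>i. E (n + i)))" for n
  proof (rule same_multiplicityI)
    fix x
    let ?F = "fibre C x <+> (SIGMA i:UNIV. fibre (E (n + i)) x)"
    have C_E: "x \<notin> C k" if "x \<in> E m k" for m k
      using that E(3)[of m k] by (auto simp: C_def)
    have E_E: "i = j" if "x \<in> E i k" "x \<in> E j k" for i j k
    proof (rule ccontr)
      assume "i \<noteq> j"
      then obtain m l where "m < l" "x \<in> E m k" "x \<in> E l k"
        using \<open>x \<in> E i k\<close> \<open>x \<in> E j k\<close> by (metis linorder_neqE_nat)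
      moreover from this have "x \<in> D (Suc m) k"
        using E_sub[of l k] antimono[of "Suc m" "l - Suc m" k] by auto
      ultimately show False using E(3)[of m k] by blast
    qed
    \<comment> \<open>a point of \<open>D n k\<close> that no layer removes stays in every later \<open>D m k\<close>\<close>
    have D_cases: "x \<in> C k \<or> (\<exists>i. x \<in> E (n + i) k)" if "x \<in> D n k" for k
    proof (rule ccontr)
      assume *: "\<not> ?thesis"
      have from_n: "x \<in> D (n + i) k" for i
      proof (induction i)
        case (Suc i)
        then show ?case using E(2)[of "n + i" k] * by auto
      qed (use that in simp)
      have "x \<in> D m k" for m
        using from_n[of m] antimono[of m n k] by (auto simp: add.commute)
      then show False using * by (simp add: C_def)
    qed
    have sub: "E (n + i) k \<subseteq> D n k" for i k using E_sub antimono by blast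
    have "bij_betw (case_sum id snd) ?F (fibre (D n) x)"
      unfolding bij_betw_def
    proof
      show "inj_on (case_sum id snd) ?F"
        unfolding inj_on_def fibre_def using C_E by (auto dest: E_E)
      have "C k \<subseteq> D n k" for k by (auto simp: C_def)
      then have "k \<in> fibre (D n) x \<longleftrightarrow> k \<in> fibre C x \<or> (\<exists>i. k \<in> fibre (E (n + i)) x)" for k
        using sub[THEN subsetD] D_cases[of k] by (auto simp: fibre_def)
      then have "fibre (D n) x = fibre C x \<union> (\<Union>i. fibre (E (n + i)) x)" by auto
      then show "case_sum id snd ` ?F = fibre (D n) x"
        by (auto simp: Plus_def image_Un image_image snd_image_Sigma)
    qed
    then have "?F \<approx> fibre (D n) x" unfolding eqpoll_def by (rule exI[of _ "case_sum id snd"])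
    then have "fibre (D n) x \<approx> ?F" by (rule eqpoll_sym)
    also have "\<dots> \<approx> fibre C x <+> fibre (countable_coproduct (\<lambda>i. E (n + i))) x"
      by (intro sum_eqpoll_cong eqpoll_refl eqpoll_sym[OF fibre_countable_coproduct])
    also have "\<dots> \<approx> fibre (coproduct2 C (countable_coproduct (\<lambda>i. E (n + i)))) x"
      by (rule eqpoll_sym[OF fibre_coproduct2])
    finally show "fibre (D n) x \<approx> \<dots>" .
  qed
  then have "type_of (D n) = type_of C \<otimes>\<^bsub>T\<^esub> type_sum (\<lambda>i. type_of (E (n + i)))" for n
    using C DE by (simp add: type_sum_type_of type_of_mult type_of_same coproduct2_closed countable_coproduct_closed)
  moreover have "a n = type_of (D n)" "b n = type_of (E n)" for n
    using A B type_of_eqI[OF D(1)] type_of_eqI[OF E(1)] by simp_all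
  ultimately have "\<forall>n. a n = type_of C \<otimes>\<^bsub>T\<^esub> type_sum (\<lambda>i. b (n + i))" by simp
  then show "\<exists>c\<in>carrier T. \<forall>n. a n = c \<otimes>\<^bsub>T\<^esub> type_sum (\<lambda>i. b (n + i))"
    using type_of_carrier[OF C] by blast
qed

end

theorem theorem2:
  fixes M :: "'x measure"
    and S :: "('s, 'm) monoid_scheme"
    and act :: "'s \<Rightarrow> 'x \<Rightarrow> 'x"
  assumes "stationarily_measurable_space M S act"
  shows "\<exists>(Q :: ('x coproduct_type \<times> 'x coproduct_type) set monoid) ord.
           inverse_monoid Q \<and>
           (\<exists>\<phi>. monoid_embedding \<phi> (type_monoid M S act) Q) \<and>
           comm_monoid Q \<and>
           partially_ordered_comm_monoid Q ord \<and>
           (\<forall>e\<in>idempotents Q. \<forall>f\<in>idempotents Q. ord e f \<longleftrightarrow> e \<otimes>\<^bsub>Q\<^esub> f = f) \<and>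
           distributive_lattice (idempotent_order Q)"
proof -
  interpret stationarily_measurable_space M S act by (rule assms)
  interpret T: countable_sum_monoid T type_sum by (rule countable_sum_monoid_type_monoid)
  interpret Q: comm_monoid T.Q by (rule T.comm_monoid_envelope)
  show ?thesis
  proof (intro exI conjI)
    show "inverse_monoid T.Q" by (rule T.inverse_monoid_envelope)
    show "monoid_embedding T.envelope_class (type_monoid M S act) T.Q" by (rule T.embedding_envelope)
    show "comm_monoid T.Q" by (rule T.comm_monoid_envelope)
    show "partially_ordered_comm_monoid T.Q (natural_order T.Q)" by (rule Q.partially_ordered_natural)
    show "\<forall>e\<in>idempotents T.Q. \<forall>f\<in>idempotents T.Q.
        natural_order T.Q e f \<longleftrightarrow> e \<otimes>\<^bsub>T.Q\<^esub> f = f"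
      by (simp add: Q.natural_order_idempotents)
    show "distributive_lattice (idempotent_order T.Q)" by (rule T.distributive_lattice_idempotents)
  qed
qed

end
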